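(* Let $m\ge 3$ and $n\ge 1$ be integers, and let $Y_{m,n}=C_m\,\square\,P_n$ be the stacked prism graph. Then its treewidth satisfies: if $m\neq 2n$, then $\operatorname{tw}(Y_{m,n})=\min\{m,2n\}$; and if $m=2n$, then $\operatorname{tw}(Y_{m,n})$ equals either $\min\{m,2n\}-1$ or $\min\{m,2n\}$. Moreover, in the case $m=2n$ both possibilities occur: there is a value of $n$ for which $\operatorname{tw}(Y_{2n,n})=2n-1$, and there is a value of $n$ for which $\operatorname{tw}(Y_{2n,n})=2n$.
   Context: $P_n$ is the path on $n$ vertices and $C_m$ is the cycle on $m$ vertices. The Cartesian product $G_1\,\square\,G_2$ has vertex set $V(G_1)\times V(G_2)$, with $(v_1,v_2)$ adjacent to $(u_1,u_2)$ iff either $v_2=u_2$ and $v_1u_1\in E(G_1)$, or $v_1=u_1$ and $v_2u_2\in E(G_2)$. A tree decomposition of a graph $G$ is a pair $(T,\mathcal V)$ with $T$ a tree and $\mathcal V=\{V_t\}_{t\in T}$ a family of subsets $V_t\subset V(G)$ indexed by the nodes of $T$ such that: (1) $\bigcup_{t}V_t=V(G)$; (2) for every edge $uv\in E(G)$ there is a node $t$ with $u,v\in V_t$; (3) if $v\in V_{t_1}\cap V_{t_2}$ then $v\in V_{t'}$ for every node $t'$ on the path from $t_1$ to $t_2$ in $T$. Its width is $\max_t(|V_t|-1)$. The treewidth $\operatorname{tw}(G)$ is the minimum width of a tree decomposition of $G$. *)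

theory Defs
  imports "Graph_Theory.Graph_Theory"
begin

text \<open>
  A graph is a finite loop-free symmetric digraph whose arcs are pairs of vertices, i.e. an instance
  of \<^locale>\<open>pair_graph\<close>; an undirected edge \<open>uv\<close> is the pair of arcs \<open>(u, v)\<close> and \<open>(v, u)\<close>.
\<close>

definition path_graph :: "nat \<Rightarrow> nat pair_pre_digraph" where
  "path_graph n =
     \<lparr> pverts = {0..<n},
       parcs = {(i, j). i < n \<and> j < n \<and> (j = Suc i \<or> i = Suc j)} \<rparr>"

text \<open>Only meaningful for \<open>m \<ge> 3\<close>; for \<open>m = 1\<close> the relation below has a loop.\<close>

definition cycle_graph :: "nat \<Rightarrow> nat pair_pre_digraph" where
  "cycle_graph m =
     \<lparr> pverts = {0..<m},
       parcs = {(i, j). i < m \<and> j < m \<and> (j = Suc i mod m \<or> i = Suc j mod m)} \<rparr>"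

definition cartesian_product ::
  "'a pair_pre_digraph \<Rightarrow> 'b pair_pre_digraph \<Rightarrow> ('a \<times> 'b) pair_pre_digraph" where
  "cartesian_product G H =
     \<lparr> pverts = pverts G \<times> pverts H,
       parcs = {((v1, v2), (u1, u2)).
          v1 \<in> pverts G \<and> v2 \<in> pverts H \<and> u1 \<in> pverts G \<and> u2 \<in> pverts H \<and>
          (v2 = u2 \<and> (v1, u1) \<in> parcs G \<or> v1 = u1 \<and> (v2, u2) \<in> parcs H)} \<rparr>"

definition stacked_prism :: "nat \<Rightarrow> nat \<Rightarrow> (nat \<times> nat) pair_pre_digraph" where
  "stacked_prism m n = cartesian_product (cycle_graph m) (path_graph n)"

text \<open>
  The constant \<^const>\<open>tree\<close> of the library is not usable here: in a symmetric digraph every edge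
  gives a directed cycle \<open>u, v, u\<close> of length 2. The cycles of the underlying undirected graph are
  the directed cycles of length at least 3. The library's \<^const>\<open>connected\<close> includes nonemptiness.
\<close>

definition undirected_tree :: "'t pair_pre_digraph \<Rightarrow> bool" where
  "undirected_tree T \<longleftrightarrow>
     pair_graph T \<and> connected (with_proj T) \<and>
     \<not> (\<exists>c. pre_digraph.cycle (with_proj T) c \<and> 3 \<le> length c)"

definition tree_decomposition ::
  "'a pair_pre_digraph \<Rightarrow> 't pair_pre_digraph \<Rightarrow> ('t \<Rightarrow> 'a set) \<Rightarrow> bool" where
  "tree_decomposition G T V \<longleftrightarrow>
     pair_graph G \<and> undirected_tree T \<and>
     (\<Union>t\<in>pverts T. V t) = pverts G \<and>
     (\<forall>u v. (u, v) \<in> parcs G \<longrightarrow> (\<exists>t\<in>pverts T. u \<in> V t \<and> v \<in> V t)) \<and>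
     (\<forall>t1\<in>pverts T. \<forall>t2\<in>pverts T. \<forall>v\<in>V t1 \<inter> V t2.
        \<forall>p. pre_digraph.apath (with_proj T) t1 p t2 \<longrightarrow>
          (\<forall>t'\<in>set (pre_digraph.awalk_verts (with_proj T) t1 p). v \<in> V t'))"

text \<open>Integer-valued, so that an empty bag contributes \<open>-1\<close>.\<close>

definition decomposition_width :: "'t pair_pre_digraph \<Rightarrow> ('t \<Rightarrow> 'a set) \<Rightarrow> int" where
  "decomposition_width T V = Max ((\<lambda>t. int (card (V t)) - 1) ` pverts T)"

text \<open>
  Taking the nodes of the decomposition trees from \<^typ>\<open>nat\<close> is no restriction, since the trees
  are finite. The least element exists for every (finite) graph, the widths being at least \<open>-1\<close>.
\<close>

definition treewidth :: "'a pair_pre_digraph \<Rightarrow> int" where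
  "treewidth G =
     (LEAST w. \<exists>(T :: nat pair_pre_digraph) V.
        tree_decomposition G T V \<and> w = decomposition_width T V)"

lemma pair_graph_path_graph: "pair_graph (path_graph n)"
proof -
  have "finite (parcs (path_graph n))"
    by (rule finite_subset[of _ "{0..<n} \<times> {0..<n}"]) (auto simp: path_graph_def)
  then show ?thesis
    by unfold_locales (auto simp: path_graph_def symmetric_def sym_def)
qed

lemma pair_graph_cycle_graph:
  assumes "3 \<le> m"
  shows "pair_graph (cycle_graph m)"
proof -
  have "finite (parcs (cycle_graph m))"
    by (rule finite_subset[of _ "{0..<m} \<times> {0..<m}"]) (auto simp: cycle_graph_def)
  moreover have "Suc i mod m \<noteq> i" if "i < m" for i
    using that assms by (auto simp: mod_Suc)
  ultimately show ?thesis
    by unfold_locales (force simp: cycle_graph_def symmetric_def sym_def)+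
qed

lemma pair_graph_cartesian_product:
  assumes "pair_graph G" "pair_graph H"
  shows "pair_graph (cartesian_product G H)"
proof -
  interpret G: pair_graph G by fact
  interpret H: pair_graph H by fact
  have "finite (parcs (cartesian_product G H))"
    by (rule finite_subset[of _ "(pverts G \<times> pverts H) \<times> (pverts G \<times> pverts H)"])
       (auto simp: cartesian_product_def)
  moreover have "sym (parcs G)" "sym (parcs H)"
    using G.pair_sym_arcs H.pair_sym_arcs by (simp_all add: symmetric_def)
  moreover have "(v, v) \<notin> parcs G" "(w, w) \<notin> parcs H" for v w
    using G.pair_no_loops H.pair_no_loops by fastforce+
  ultimately show ?thesis
    by unfold_locales (auto simp: cartesian_product_def symmetric_def sym_def)
qed

lemma pair_graph_stacked_prism: "3 \<le> m \<Longrightarrow> pair_graph (stacked_prism m n)"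
  unfolding stacked_prism_def
  by (intro pair_graph_cartesian_product pair_graph_cycle_graph pair_graph_path_graph)

end

theory Submission
  imports Defs
begin

text \<open>
  Upper bounds: sweep the prism row by row, or column by column keeping one column in every bag; for
  the cube, take a star whose centre is one colour class.

  Lower bounds: the nodes whose bags meet a connected set form a convex set of the tree, so by the
  Helly property some bag meets every member of a given bramble. Hence a bramble is needed that no
  set \<open>X\<close> of \<open>k\<close> vertices covers. If \<open>X\<close> misses a column, or if in two neighbouring columns the only
  removed vertices have heights differing by at least two, then a connected set avoiding \<open>X\<close> meets
  all rows; either it almost contains a row, or each row has exactly two removed vertices, which cut
  the prism into two sides, the larger of which is taken. Otherwise every column has exactly one
  removed vertex, the heights of these vertices vary by at most one from column to column, and the
  larger of the parts below and above them is taken. The two kinds of sets touch by counting row by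
  row, respectively column by column.

  For \<open>m = 2 n\<close> the counting is tight, and \<open>n \<ge> 3\<close> is exactly what makes it work with \<open>k = 2 n\<close>.
\<close>

section \<open>Convex sets in trees and brambles\<close>

text \<open>Membership in the bramble must be decided by the set alone, not by the \<open>X\<close>
  it avoids, or else sets avoiding different \<open>X\<close> could not be compared. Sets above half
  therefore touch; at exactly half, a tie-break never admits both of two sets that do not touch.

  The obstacle is connectivity, as a side cut off by \<open>X\<close> may fall apart. A disconnected
  side turns out to be small: at most \<open>1 + (n - 1)^2\<close> vertices when each row loses two,
  at most \<open>1 + (m - 2)^2 / 4\<close> when each column loses one. For \<open>m = 2 * n\<close>,
  either bound is below half of what remains exactly if \<open>2 < n\<close>; for the cube,
  \<open>n = 2\<close>, both comparisons become equalities.\<close>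

definition path_in :: "('t \<times> 't) set \<Rightarrow> 't list \<Rightarrow> bool" where
  "path_in E p \<longleftrightarrow> p \<noteq> [] \<and> distinct p \<and> successively (\<lambda>x y. (x, y) \<in> E) p"

text \<open>All paths between the two ends are meant, as in the third condition of
  \<open>tree_decomposition\<close>. Paths are vertex lists, which are easier to cut and reverse
  than arc walks.\<close>

definition path_convex :: "('t \<times> 't) set \<Rightarrow> 't set \<Rightarrow> bool" where
  "path_convex E C \<longleftrightarrow> (\<forall>p. path_in E p \<longrightarrow> hd p \<in> C \<longrightarrow> last p \<in> C \<longrightarrow> set p \<subseteq> C)"

definition path_connected_on :: "('t \<times> 't) set \<Rightarrow> 't set \<Rightarrow> bool" where
  "path_connected_on E P \<longleftrightarrow> (\<forall>u\<in>P. \<forall>v\<in>P. \<exists>p. path_in E p \<and> hd p = u \<and> last p = v)"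

lemma path_convexD:
  "path_convex E C \<Longrightarrow> path_in E p \<Longrightarrow> hd p \<in> C \<Longrightarrow> last p \<in> C \<Longrightarrow> x \<in> set p \<Longrightarrow> x \<in> C"
  unfolding path_convex_def by blast

lemma path_convex_Int: "path_convex E C \<Longrightarrow> path_convex E D \<Longrightarrow> path_convex E (C \<inter> D)"
  unfolding path_convex_def by simp

lemma successively_rev_sym:
  "sym E \<Longrightarrow> successively (\<lambda>x y. (x, y) \<in> E) (rev p) = successively (\<lambda>x y. (x, y) \<in> E) p"
  by (auto simp: dest: symD elim!: successively_mono)

text \<open>Attach to a path \<open>p\<close> a path leading from \<open>c\<close> to \<open>p\<close> that meets \<open>p\<close> only in \<open>m\<close>:
  continuing in either direction along \<open>p\<close> gives a path again.\<close>

lemma path_in_median: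
  assumes E: "sym E" and p: "path_in E p" and q: "path_in E q" "last q = hd p"
  obtains m p1 p2 q1 where "p = p1 @ m # p2" "hd (q1 @ [m]) = hd q"
    "path_in E (q1 @ m # rev p1)" "path_in E (q1 @ m # p2)"
proof -
  have "\<exists>x\<in>set q. x \<in> set p"
    using p q by (metis hd_in_set last_in_set path_in_def)
  then obtain q1 m q2 where q1: "q = q1 @ m # q2" "m \<in> set p" "\<forall>x\<in>set q1. x \<notin> set p"
    using split_list_first_prop[of q "\<lambda>x. x \<in> set p"] by blast
  then obtain p1 p2 where p1: "p = p1 @ m # p2"
    by (meson split_list)
  have sp: "successively (\<lambda>x y. (x, y) \<in> E) (p1 @ [m])" "successively (\<lambda>x y. (x, y) \<in> E) (m # p2)"
    "successively (\<lambda>x y. (x, y) \<in> E) (q1 @ [m])"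
    using p q unfolding path_in_def p1 q1 by (auto simp: successively_append_iff successively_Cons)
  have "successively (\<lambda>x y. (x, y) \<in> E) (m # rev p1)"
    using sp(1) successively_rev_sym[OF E, of "p1 @ [m]"] by simp
  with sp p q q1 have "path_in E (q1 @ m # rev p1)" "path_in E (q1 @ m # p2)"
    unfolding path_in_def p1 q1 by (auto simp: successively_append_iff successively_Cons)
  moreover have "hd (q1 @ [m]) = hd q"
    using q1 by (cases q1) auto
  ultimately show ?thesis
    using p1 that by blast
qed

text \<open>The vertex \<open>m\<close> is where a path from \<open>c\<close> first reaches
  \<open>p\<close>, so the ways from \<open>c\<close> through \<open>m\<close> to either end of
  \<open>p\<close> are paths themselves. Quantifying over \<open>A\<close> inside lets the same
  \<open>m\<close> serve several convex sets.\<close>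

lemma median_convex:
  assumes E: "sym E" and P: "path_connected_on E P"
    and p: "path_in E p" "hd p \<in> P" "last p \<in> P" and c: "c \<in> P"
  shows "\<exists>m p1 p2. p = p1 @ m # p2 \<and>
    (\<forall>A. path_convex E A \<longrightarrow> c \<in> A \<longrightarrow>
      (hd p \<in> A \<longrightarrow> insert m (set p1) \<subseteq> A) \<and> (last p \<in> A \<longrightarrow> insert m (set p2) \<subseteq> A))"
proof -
  obtain q where q: "path_in E q" "hd q = c" "last q = hd p"
    using P p c unfolding path_connected_on_def by blast
  obtain m p1 p2 q1 where m: "p = p1 @ m # p2" "hd (q1 @ [m]) = hd q"
    "path_in E (q1 @ m # rev p1)" "path_in E (q1 @ m # p2)"
    by (rule path_in_median[OF E p(1) q(1,3)])
  have h: "hd (q1 @ m # r) = c" for r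
    using m(2) q(2) by (cases q1) auto
  have l1: "last (q1 @ m # rev p1) = hd p" and l2: "last (q1 @ m # p2) = last p"
    using m(1) by (auto simp: hd_append last_rev)
  have "insert m (set p1) \<subseteq> A" if "path_convex E A" "c \<in> A" "hd p \<in> A" for A
    using path_convexD[OF that(1) m(3)] that h l1 by auto
  moreover have "insert m (set p2) \<subseteq> A" if "path_convex E A" "c \<in> A" "last p \<in> A" for A
    using path_convexD[OF that(1) m(4)] that h l2 by auto
  ultimately show ?thesis
    using m(1) by blast
qed

text \<open>With \<open>c\<close> common to both sets, the median cuts a path into two halves; each
  half lies in whichever of \<open>A\<close> and \<open>B\<close> contains its outer end.\<close>

lemma path_convex_Un:
  assumes "sym E" "path_connected_on E P" "path_convex E A" "path_convex E B"
    and sub: "A \<subseteq> P" "B \<subseteq> P" and "A \<inter> B \<noteq> {}"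
  shows "path_convex E (A \<union> B)"
proof -
  obtain c where c: "c \<in> A" "c \<in> B"
    using assms by blast
  have "x \<in> A \<union> B"
    if p: "path_in E p" "hd p \<in> A \<union> B" "last p \<in> A \<union> B" "x \<in> set p" for p x
  proof -
    have "hd p \<in> P" "last p \<in> P" "c \<in> P"
      using p sub c by auto
    then obtain m p1 p2 where m: "p = p1 @ m # p2"
      "\<And>A. path_convex E A \<Longrightarrow> c \<in> A \<Longrightarrow> hd p \<in> A \<Longrightarrow> insert m (set p1) \<subseteq> A"
      "\<And>A. path_convex E A \<Longrightarrow> c \<in> A \<Longrightarrow> last p \<in> A \<Longrightarrow> insert m (set p2) \<subseteq> A"
      using median_convex[OF assms(1,2) p(1), of c] by auto
    have "insert m (set p1) \<subseteq> A \<union> B" "insert m (set p2) \<subseteq> A \<union> B"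
      using m(2,3) assms(3,4) c p(2,3) by blast+
    then show ?thesis
      using p(4) m(1) by auto
  qed
  then show ?thesis
    unfolding path_convex_def by blast
qed

text \<open>The median of three points, one from each pairwise intersection, lies in all three
  sets.\<close>

lemma path_convex_triple:
  assumes "sym E" "path_connected_on E P" "path_convex E A" "path_convex E B" "path_convex E C"
    and "A \<subseteq> P" "B \<subseteq> P" "C \<subseteq> P" "A \<inter> B \<noteq> {}" "A \<inter> C \<noteq> {}" "B \<inter> C \<noteq> {}"
  shows "A \<inter> B \<inter> C \<noteq> {}"
proof -
  obtain a b c where abc: "a \<in> B" "a \<in> C" "b \<in> A" "b \<in> C" "c \<in> A" "c \<in> B"
    using assms by blast
  then obtain p where p: "path_in E p" "hd p = a" "last p = b"
    using assms unfolding path_connected_on_def by (meson subsetD)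
  have "hd p \<in> P" "last p \<in> P" "c \<in> P"
    using p abc assms(6-8) by auto
  then obtain m p1 p2 where m: "p = p1 @ m # p2"
    "\<And>A. path_convex E A \<Longrightarrow> c \<in> A \<Longrightarrow> hd p \<in> A \<Longrightarrow> insert m (set p1) \<subseteq> A"
    "\<And>A. path_convex E A \<Longrightarrow> c \<in> A \<Longrightarrow> last p \<in> A \<Longrightarrow> insert m (set p2) \<subseteq> A"
    using median_convex[OF assms(1,2) p(1), of c] by auto
  have "m \<in> B"
    using m(2)[OF assms(4)] abc p(2) by blast
  moreover have "m \<in> A"
    using m(3)[OF assms(3)] abc p(3) by blast
  moreover have "m \<in> C"
    using path_convexD[OF assms(5) p(1), of m] abc p(2,3) m(1) by simp
  ultimately show ?thesis
    by blast
qed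

text \<open>In the induction step every set is replaced by its intersection with \<open>f k\<close>;
  these intersect pairwise by the case of three sets.\<close>

lemma path_convex_Helly:
  assumes E: "sym E" "path_connected_on E P" and "finite I" "I \<noteq> {}"
    and "\<And>i. i \<in> I \<Longrightarrow> path_convex E (f i) \<and> f i \<subseteq> P"
    and "\<And>i j. i \<in> I \<Longrightarrow> j \<in> I \<Longrightarrow> f i \<inter> f j \<noteq> {}"
  shows "\<exists>t\<in>P. \<forall>i\<in>I. t \<in> f i"
  using assms(3-)
proof (induction I arbitrary: f rule: finite_ne_induct)
  case (singleton i)
  have "f i \<noteq> {}" "f i \<subseteq> P"
    using singleton.prems(1)[of i] singleton.prems(2)[of i i] by simp_all
  then show ?case
    by blast
next
  case (insert k I)
  let ?g = "\<lambda>i. f k \<inter> f i"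
  have conv: "path_convex E (f i)" and sub: "f i \<subseteq> P" if "i \<in> insert k I" for i
    using insert.prems(1)[OF that] by simp_all
  have "\<exists>t\<in>P. \<forall>i\<in>I. t \<in> ?g i"
  proof (rule insert.IH)
    show "path_convex E (?g i) \<and> ?g i \<subseteq> P" if "i \<in> I" for i
      using that conv sub by (simp add: path_convex_Int le_infI1)
  next
    show "?g i \<inter> ?g j \<noteq> {}" if "i \<in> I" "j \<in> I" for i j
    proof -
      have "f k \<inter> f i \<inter> f j \<noteq> {}"
        by (rule path_convex_triple[OF E]) (simp_all add: conv sub that insert.prems(2))
      then show ?thesis
        by blast
    qed
  qed
  then obtain t where t: "t \<in> P" "\<forall>i\<in>I. t \<in> f k \<inter> f i" ..
  moreover obtain i where "i \<in> I"
    using \<open>I \<noteq> {}\<close> by blast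
  ultimately show ?case
    by (intro bexI[of _ t]) auto
qed

section \<open>Connected vertex sets\<close>

definition linked :: "('a \<times> 'a) set \<Rightarrow> 'a set \<Rightarrow> bool" where
  "linked E S \<longleftrightarrow> (\<forall>u\<in>S. \<forall>v\<in>S. (u, v) \<in> (E \<inter> S \<times> S)\<^sup>*)"

definition touches :: "('a \<times> 'a) set \<Rightarrow> 'a set \<Rightarrow> 'a set \<Rightarrow> bool" where
  "touches E S T \<longleftrightarrow> S \<inter> T \<noteq> {} \<or> (\<exists>u\<in>S. \<exists>v\<in>T. (u, v) \<in> E)"

lemma touches_sym: "sym E \<Longrightarrow> touches E S T \<Longrightarrow> touches E T S"
  unfolding touches_def by (blast dest: symD)

text \<open>Counting the empty set as linked spares case distinctions for segments of rows and
  columns that may be empty.\<close>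

lemma linked_empty [simp]: "linked E {}"
  and linked_singleton [simp]: "linked E {v}"
  unfolding linked_def by auto

lemma linked_Un:
  assumes "sym E" "linked E S" "linked E T" "touches E S T"
  shows "linked E (S \<union> T)"
proof -
  let ?R = "(E \<inter> (S \<union> T) \<times> (S \<union> T))\<^sup>*"
  have S: "(u, v) \<in> ?R" if "u \<in> S" "v \<in> S" for u v
    using assms(2) that rtrancl_mono[of "E \<inter> S \<times> S" "E \<inter> (S \<union> T) \<times> (S \<union> T)"]
    unfolding linked_def by blast
  have T: "(u, v) \<in> ?R" if "u \<in> T" "v \<in> T" for u v
    using assms(3) that rtrancl_mono[of "E \<inter> T \<times> T" "E \<inter> (S \<union> T) \<times> (S \<union> T)"]
    unfolding linked_def by blast
  have "sym ?R"
    by (intro sym_rtrancl) (use assms(1) in \<open>auto simp: sym_def\<close>)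
  obtain s t where st: "s \<in> S" "t \<in> T" "(s, t) \<in> ?R"
    using assms(4) unfolding touches_def by auto
  have ST: "(u, v) \<in> ?R" if "u \<in> S" "v \<in> T" for u v
    using S[OF that(1) st(1)] st(3) T[OF st(2) that(2)] by (meson rtrancl_trans)
  show ?thesis
    unfolding linked_def using S T ST symD[OF \<open>sym ?R\<close>] by blast
qed

lemma linked_UN_chain:
  assumes "sym E" and "\<And>i. i \<le> (n :: nat) \<Longrightarrow> linked E (f i)"
    and "\<And>i. i < n \<Longrightarrow> touches E (f i) (f (Suc i))"
  shows "linked E (\<Union>i\<le>n. f i)"
  using assms(2-)
proof (induction n)
  case (Suc n)
  have "touches E (\<Union>i\<le>n. f i) (f (Suc n))"
    using Suc.prems(2)[of n] unfolding touches_def by auto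
  moreover have "linked E (\<Union>i\<le>n. f i)"
    by (rule Suc.IH) (simp_all add: Suc.prems)
  ultimately have "linked E ((\<Union>i\<le>n. f i) \<union> f (Suc n))"
    using Suc.prems(1)[of "Suc n"] by (intro linked_Un \<open>sym E\<close>) auto
  then show ?case
    by (simp add: atMost_Suc Un_commute)
qed simp

lemma linked_UN_star:
  assumes "sym E" "finite I" "linked E T"
    and "\<And>i. i \<in> I \<Longrightarrow> linked E (f i) \<and> touches E T (f i)"
  shows "linked E (T \<union> (\<Union>i\<in>I. f i))"
  using assms(2,4)
proof (induction I)
  case (insert i I)
  have "touches E (T \<union> (\<Union>i\<in>I. f i)) (f i)"
    using insert.prems[of i] unfolding touches_def by auto
  moreover have "linked E (T \<union> (\<Union>i\<in>I. f i))"
    by (rule insert.IH) (simp add: insert.prems)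
  ultimately have "linked E ((T \<union> (\<Union>i\<in>I. f i)) \<union> f i)"
    using insert.prems[of i] by (metis linked_Un[OF \<open>sym E\<close>] insertI1)
  then show ?case
    by (simp add: Un_ac)
qed (use assms in simp)

text \<open>An inclusion-maximal linked set between \<open>K\<close> and \<open>W\<close> absorbs
  every linked set in \<open>W\<close> that it touches, since the union would again be
  linked.\<close>

lemma linked_component:
  assumes "sym E" "finite W" "linked E K" "K \<subseteq> W"
  obtains S where "K \<subseteq> S" "S \<subseteq> W" "linked E S" "\<And>T. linked E T \<Longrightarrow> T \<subseteq> W \<Longrightarrow> touches E S T \<Longrightarrow> T \<subseteq> S"
proof -
  let ?P = "\<lambda>S. K \<subseteq> S \<and> S \<subseteq> W \<and> linked E S"
  have "finite {S. ?P S}"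
    by (rule finite_subset[of _ "Pow W"]) (use \<open>finite W\<close> in auto)
  moreover have "K \<in> {S. ?P S}"
    using assms by simp
  ultimately have "\<exists>S\<in>{S. ?P S}. \<forall>S'\<in>{S. ?P S}. S \<subseteq> S' \<longrightarrow> S = S'"
    by (intro finite_has_maximal) auto
  then obtain S where "S \<in> {S. ?P S}" and max: "\<forall>S'\<in>{S. ?P S}. S \<subseteq> S' \<longrightarrow> S = S'" ..
  then have S1: "?P S"
    by simp
  have S2: "S = S'" if "?P S'" "S \<subseteq> S'" for S'
    using max that by simp
  note S = S1 S2
  show ?thesis
  proof (rule that)
    fix T assume T: "linked E T" "T \<subseteq> W" "touches E S T"
    have "linked E (S \<union> T)"
      using S(1) T by (intro linked_Un assms) auto
    then have "S = S \<union> T"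
      using S T by (intro S(2)) auto
    then show "T \<subseteq> S"
      by blast
  qed (use S in auto)
qed

text \<open>In the application, \<open>f v\<close> is the set of nodes whose bags contain \<open>v\<close>.\<close>

lemma path_convex_UN_linked:
  assumes E: "sym E" "path_connected_on E P" and "finite S" "linked G S"
    and f: "\<And>v. v \<in> S \<Longrightarrow> path_convex E (f v) \<and> f v \<subseteq> P"
    and adj: "\<And>u v. (u, v) \<in> G \<Longrightarrow> f u \<inter> f v \<noteq> {}"
  shows "path_convex E (\<Union>v\<in>S. f v)"
proof (cases "S = {}")
  case True
  then show ?thesis
    by (simp add: path_convex_def)
next
  case False
  then obtain u where u: "u \<in> S"
    by blast
  \<comment> \<open>Take a maximal \<open>R\<close> with convex union. Along a walk in
    \<open>S\<close> from \<open>u\<close>, each new vertex could be added to \<open>R\<close>,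
    because its set meets that of its predecessor; hence \<open>R = S\<close>.\<close>
  let ?Q = "\<lambda>R. u \<in> R \<and> R \<subseteq> S \<and> path_convex E (\<Union>v\<in>R. f v)"
  have "finite {R. ?Q R}"
    by (rule finite_subset[of _ "Pow S"]) (use \<open>finite S\<close> in auto)
  moreover have "{u} \<in> {R. ?Q R}"
    using u f by simp
  ultimately have "\<exists>R\<in>{R. ?Q R}. \<forall>R'\<in>{R. ?Q R}. R \<subseteq> R' \<longrightarrow> R = R'"
    by (intro finite_has_maximal) auto
  then obtain R where "R \<in> {R. ?Q R}" and max: "\<forall>R'\<in>{R. ?Q R}. R \<subseteq> R' \<longrightarrow> R = R'" ..
  then have R1: "?Q R"
    by simp
  have R2: "R = R'" if "?Q R'" "R \<subseteq> R'" for R'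
    using max that by simp
  note R = R1 R2
  have "v \<in> R" if "(u, v) \<in> (G \<inter> S \<times> S)\<^sup>*" for v
    using that
  proof induction
    case (step v w)
    then have "f v \<inter> f w \<noteq> {}" "w \<in> S"
      using adj by auto
    moreover have "(\<Union>v\<in>R. f v) \<subseteq> P"
      using R(1) f by blast
    ultimately have "path_convex E ((\<Union>v\<in>R. f v) \<union> f w)"
      using R(1) f[of w] step.IH by (intro path_convex_Un[OF E]) auto
    then have "R = insert w R"
      using R(1) \<open>w \<in> S\<close> by (intro R(2)) (auto simp: Un_commute)
    then show ?case
      by blast
  qed (use R in blast)
  then have "R = S"
    using R(1) \<open>linked G S\<close> u unfolding linked_def by blast
  then show ?thesis
    using R(1) by simp
qed

section \<open>Vertex lists and arc walks\<close>

lemma successively_imp_apath: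
  assumes "pair_wf_digraph T" "path_in (parcs T) q" "set q \<subseteq> pverts T"
  shows "\<exists>p. pre_digraph.apath (with_proj T) (hd q) p (last q) \<and>
             pre_digraph.awalk_verts (with_proj T) (hd q) p = q"
proof -
  interpret pair_wf_digraph T by fact
  have "\<exists>p. awalk (hd q) p (last q) \<and> awalk_verts (hd q) p = q"
    using assms(2,3) unfolding path_in_def
  proof (induction q rule: induct_list012)
    case (2 x)
    then show ?case
      by (intro exI[of _ "[]"]) (auto simp: awalk_Nil_iff)
  next
    case (3 x y zs)
    then have "\<exists>p. awalk (hd (y # zs)) p (last (y # zs)) \<and> awalk_verts (hd (y # zs)) p = y # zs"
      by (intro "3.IH"(2)) auto
    then obtain p where "awalk y p (last (y # zs))" "awalk_verts y p = y # zs"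
      unfolding list.sel by blast
    moreover have "x \<in> pverts T" "(x, y) \<in> parcs T"
      using 3 by auto
    ultimately show ?case
      by (intro exI[of _ "(x, y) # p"]) (simp add: awalk_Cons_iff)
  qed simp
  then obtain p where "awalk (hd q) p (last q)" "awalk_verts (hd q) p = q"
    by blast
  moreover have "distinct q"
    using assms(2) by (simp add: path_in_def)
  ultimately show ?thesis
    unfolding apath_def by (intro exI[of _ p]) simp
qed

lemma awalk_imp_successively:
  assumes "pair_wf_digraph T" "pre_digraph.awalk (with_proj T) u p v"
  shows "successively (\<lambda>x y. (x, y) \<in> parcs T) (pawalk_verts u p)"
    and "hd (pawalk_verts u p) = u"
    and "last (pawalk_verts u p) = v"
proof -
  interpret pair_wf_digraph T by fact
  have *: "awalk u p v" by (rule assms(2))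
  then show "hd (pawalk_verts u p) = u" "last (pawalk_verts u p) = v"
    by auto
  show "successively (\<lambda>x y. (x, y) \<in> parcs T) (pawalk_verts u p)"
    using *
  proof (induction p arbitrary: u)
    case (Cons e p)
    then have "hd (pawalk_verts (snd e) p) = snd e" "e \<in> parcs T" "fst e = u"
      by (auto simp: awalk_Cons_iff)
    then show ?case
      using Cons by (cases e) (auto simp: awalk_Cons_iff successively_Cons)
  qed simp
qed

lemma undirected_treeD:
  assumes "undirected_tree T"
  shows "pair_graph T" "finite (pverts T)" "pverts T \<noteq> {}" "sym (parcs T)"
    "path_connected_on (parcs T) (pverts T)"
proof -
  show "pair_graph T"
    using assms unfolding undirected_tree_def by blast
  then interpret pair_graph T .
  show "finite (pverts T)" "sym (parcs T)"
    using pair_sym_arcs by (simp_all add: symmetric_def)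
  have con: "connected (with_proj T)"
    using assms unfolding undirected_tree_def by blast
  then have sc: "strongly_connected (with_proj T)"
    by (rule symmetric_connected_imp_strongly_connected[OF sym_arcs])
  then show "pverts T \<noteq> {}"
    unfolding strongly_connected_def by simp
  show "path_connected_on (parcs T) (pverts T)"
    unfolding path_connected_on_def
  proof (intro ballI)
    fix u v assume "u \<in> pverts T" "v \<in> pverts T"
    then obtain p where p: "apath u p v"
      using sc unfolding strongly_connected_def reachable_apath by auto
    then have "path_in (parcs T) (awalk_verts u p)" "hd (awalk_verts u p) = u"
      "last (awalk_verts u p) = v"
      using awalk_imp_successively[OF pair_wf_digraph, of u p v]
      unfolding apath_def path_in_def by auto
    then show "\<exists>p. path_in (parcs T) p \<and> hd p = u \<and> last p = v"
      by blast
  qed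
qed

text \<open>The sets of nodes whose bags meet the members of a bramble are convex and pairwise intersecting.\<close>

theorem bramble_hitting_bag:
  assumes td: "tree_decomposition G T V" and "finite F" "F \<noteq> {}"
    and F: "\<And>S. S \<in> F \<Longrightarrow> S \<subseteq> pverts G \<and> linked (parcs G) S"
    and touch: "\<And>S S'. S \<in> F \<Longrightarrow> S' \<in> F \<Longrightarrow> touches (parcs G) S S'"
  shows "\<exists>t\<in>pverts T. \<forall>S\<in>F. V t \<inter> S \<noteq> {}"
proof -
  have tree: "undirected_tree T" and G: "pair_graph G"
    using td unfolding tree_decomposition_def by auto
  note T = undirected_treeD[OF tree]
  interpret T: pair_graph T by (rule T)
  interpret G: pair_graph G by fact
  define f where "f v = {t \<in> pverts T. v \<in> V t}" for v
  have conv: "path_convex (parcs T) (f v)" for v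
    unfolding path_convex_def
  proof (intro allI impI subsetI)
    fix q t assume q: "path_in (parcs T) q" "hd q \<in> f v" "last q \<in> f v" "t \<in> set q"
    \<comment> \<open>The last vertex is a node because it lies in \<open>f v\<close>, every other
      one because an arc leaves it.\<close>
    have "set q \<subseteq> pverts T"
    proof
      fix x assume "x \<in> set q"
      then obtain q1 q2 where "q = q1 @ x # q2"
        by (meson split_list)
      then show "x \<in> pverts T"
        using q by (cases q2)
          (auto simp: path_in_def successively_append_iff f_def dest: T.in_arcsD1)
    qed
    then obtain p where p: "T.apath (hd q) p (last q)" "T.awalk_verts (hd q) p = q"
      using successively_imp_apath[OF T.pair_wf_digraph q(1)] by auto
    have "\<forall>t'\<in>set (pre_digraph.awalk_verts (with_proj T) (hd q) p). v \<in> V t'"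
      using td p(1) q(2,3) unfolding tree_decomposition_def f_def by blast
    then show "t \<in> f v"
      using p(2) q(4) \<open>set q \<subseteq> pverts T\<close> unfolding f_def by auto
  qed
  have adj: "f u \<inter> f v \<noteq> {}" if "(u, v) \<in> parcs G" for u v
    using td that unfolding tree_decomposition_def f_def by blast
  have cover: "f v \<noteq> {}" if "v \<in> pverts G" for v
    using td that unfolding tree_decomposition_def f_def by blast
  let ?g = "\<lambda>S. \<Union>v\<in>S. f v"
  have "\<exists>t\<in>pverts T. \<forall>S\<in>F. t \<in> ?g S"
  proof (rule path_convex_Helly[OF T(4,5) \<open>finite F\<close> \<open>F \<noteq> {}\<close>])
    fix S assume S: "S \<in> F"
    have "finite S"
      using F[OF S] G.pair_finite_verts finite_subset by blast
    moreover have sub: "f v \<subseteq> pverts T" for v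
      by (auto simp: f_def)
    ultimately have "path_convex (parcs T) (?g S)"
      using F[OF S] by (intro path_convex_UN_linked[OF T(4,5) _ _ _ adj]) (simp_all add: conv)
    then show "path_convex (parcs T) (?g S) \<and> ?g S \<subseteq> pverts T"
      using sub by blast
  next
    fix S S' assume "S \<in> F" "S' \<in> F"
    then have t: "touches (parcs G) S S'" and sub: "S \<subseteq> pverts G"
      using touch F by simp_all
    have "\<exists>u\<in>S. \<exists>v\<in>S'. f u \<inter> f v \<noteq> {}"
      using t unfolding touches_def
    proof
      assume "S \<inter> S' \<noteq> {}"
      then obtain x where "x \<in> S" "x \<in> S'"
        by blast
      moreover from this have "f x \<inter> f x \<noteq> {}"
        using cover[of x] sub by blast
      ultimately show ?thesis
        by blast
    next
      assume "\<exists>u\<in>S. \<exists>v\<in>S'. (u, v) \<in> parcs G"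
      then show ?thesis
        using adj by meson
    qed
    then show "?g S \<inter> ?g S' \<noteq> {}"
      by auto
  qed
  then show ?thesis
    unfolding f_def by blast
qed

section \<open>Trees given by a parent function\<close>

text \<open>With parents numbered before their children, arguments about paths and cycles reduce to
  inspecting the vertex with the largest number.\<close>

definition parent_tree :: "nat \<Rightarrow> (nat \<Rightarrow> nat) \<Rightarrow> nat pair_pre_digraph" where
  "parent_tree N par =
     \<lparr> pverts = {..<N},
       parcs = {(i, j). i < N \<and> j < N \<and> (0 < i \<and> j = par i \<or> 0 < j \<and> i = par j)} \<rparr>"

lemma pverts_parent_tree [simp]: "pverts (parent_tree N par) = {..<N}"
  by (simp add: parent_tree_def)

lemma parcs_parent_tree:
  "(i, j) \<in> parcs (parent_tree N par) \<longleftrightarrow>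
     i < N \<and> j < N \<and> (0 < i \<and> j = par i \<or> 0 < j \<and> i = par j)"
  by (simp add: parent_tree_def)

context
  fixes par :: "nat \<Rightarrow> nat" and N :: nat
  assumes par: "\<And>i. 0 < i \<Longrightarrow> par i < i"
begin

lemma parent_tree_below:
  assumes "(x, y) \<in> parcs (parent_tree N par) \<or> (y, x) \<in> parcs (parent_tree N par)" "y \<le> x"
  shows "y = par x" "y < x"
proof -
  have "y \<noteq> x"
    using assms(1) par[of x] by (auto simp: parcs_parent_tree)
  then have "y < x"
    using assms(2) by simp
  then show "y < x" "y = par x"
    using assms(1) par[of y] by (auto simp: parcs_parent_tree)
qed

lemma pair_graph_parent_tree: "pair_graph (parent_tree N par)"
proof -
  have "finite (parcs (parent_tree N par))"
    by (rule finite_subset[of _ "{..<N} \<times> {..<N}"]) (auto simp: parcs_parent_tree)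
  moreover have "i \<noteq> par i" if "0 < i" for i
    using par[OF that] by simp
  ultimately show ?thesis
    by unfold_locales (auto simp: symmetric_def sym_def parcs_parent_tree)
qed

text \<open>The largest vertex of a path cannot be an inner one: both its neighbours would be its parent.\<close>

lemma parent_tree_path_closed:
  assumes C: "\<And>s t. s \<in> C \<Longrightarrow> t \<in> C \<Longrightarrow> s < t \<Longrightarrow> par t \<in> C"
  shows "path_in (parcs (parent_tree N par)) p \<Longrightarrow> hd p \<in> C \<Longrightarrow> last p \<in> C \<Longrightarrow> set p \<subseteq> C"
proof (induction "length p" arbitrary: p rule: less_induct)
  case less
  let ?E = "parcs (parent_tree N par)"
  define M where "M = Max (set p)"
  have "set p \<noteq> {}"
    using less.prems(1) by (simp add: path_in_def)
  then have M: "M \<in> set p" "\<And>x. x \<in> set p \<Longrightarrow> x \<le> M"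
    unfolding M_def by (simp_all add: Max_in)
  obtain a b where p: "p = a @ M # b"
    using M(1) by (meson split_list)
  have left: "x = par M \<and> x < M \<and> path_in ?E (a' @ [x])" if "a = a' @ [x]" for a' x
    using less.prems(1) parent_tree_below[of M x] M(2)[of x] that
    unfolding p path_in_def by (auto simp: successively_append_iff)
  have right: "y = par M \<and> y < M \<and> path_in ?E (y # b')" if "b = y # b'" for b' y
    using less.prems(1) parent_tree_below[of M y] M(2)[of y] that
    unfolding p path_in_def by (auto simp: successively_append_iff)
  consider "a = []" "b = []" | y b' where "a = []" "b = y # b'" | a' x where "a = a' @ [x]" "b = []"
    | a' x y b' where "a = a' @ [x]" "b = y # b'"
    by (metis list.exhaust rev_exhaust)
  then show ?case
  proof cases
    case 1
    then show ?thesis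
      using less.prems p by simp
  next
    case 2
    have lt: "last (y # b') < M"
      using M(2)[of "last (y # b')"] less.prems(1) last_in_set[of "y # b'"] unfolding p 2 path_in_def
      by (metis append_Nil distinct.simps(2) insert_iff le_neq_implies_less list.distinct(1) list.simps(15))
    have "M \<in> C" "last (y # b') \<in> C"
      using less.prems(2,3) unfolding p 2 by simp_all
    \<comment> \<open>The rest of the path starts at \<open>par M\<close>, which lies in
      \<open>C\<close> because \<open>M\<close> and the smaller last vertex do.\<close>
    then have "set (y # b') \<subseteq> C"
      using right[OF 2(2)] C[OF _ _ lt] by (intro less.hyps) (auto simp: p 2)
    then show ?thesis
      using \<open>M \<in> C\<close> unfolding p 2 by simp
  next
    case 3
    have "hd (a' @ [x]) \<in> set (a' @ [x])"
      by (rule hd_in_set) simp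
    then have lt: "hd (a' @ [x]) < M"
      using M(2)[of "hd (a' @ [x])"] less.prems(1) unfolding p 3 path_in_def
      by (auto simp: le_less)
    have "M \<in> C" "hd (a' @ [x]) \<in> C"
      using less.prems(2,3) unfolding p 3 by (cases a'; simp)+
    then have "set (a' @ [x]) \<subseteq> C"
      using left[OF 3(1)] C[OF _ _ lt] by (intro less.hyps) (auto simp: p 3)
    then show ?thesis
      using \<open>M \<in> C\<close> unfolding p 3 by simp
  next
    case 4
    then have "x = y"
      using left[OF 4(1)] right[OF 4(2)] by simp
    then show ?thesis
      using less.prems(1) unfolding p 4 path_in_def by simp
  qed
qed

lemma connected_parent_tree:
  assumes "0 < N"
  shows "connected (with_proj (parent_tree N par))"
proof -
  interpret T: pair_graph "parent_tree N par" by (rule pair_graph_parent_tree)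
  let ?T = "with_proj (parent_tree N par)"
  have adj: "u \<rightarrow>\<^sup>*\<^bsub>?T\<^esub> v" if "(u, v) \<in> parcs (parent_tree N par)" for u v
    by (rule T.reachable_adjI) (use that in \<open>simp add: arcs_ends_def arc_to_ends_def\<close>)
  have "i \<rightarrow>\<^sup>*\<^bsub>?T\<^esub> 0 \<and> 0 \<rightarrow>\<^sup>*\<^bsub>?T\<^esub> i" if "i < N" for i
    using that
  proof (induction i rule: less_induct)
    case (less i)
    show ?case
    proof (cases "i = 0")
      case True
      then show ?thesis
        using assms by (simp add: T.reachable_refl)
    next
      case False
      then have "(i, par i) \<in> parcs (parent_tree N par)" "(par i, i) \<in> parcs (parent_tree N par)"
        "par i < i" "par i < N"
        using less.prems par[of i] by (auto simp: parcs_parent_tree)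
      then show ?thesis
        using less.IH[of "par i"] adj by (meson T.reachable_trans)
    qed
  qed
  then show ?thesis
    by (intro T.connectedI T.reachable_mk_symmetricI)
      (use assms in \<open>auto intro: T.reachable_trans\<close>)
qed

text \<open>Both neighbours of the largest vertex \<open>M\<close> on a cycle would be
  \<open>par M\<close>, whereas on a cycle of length at least 3 they differ.\<close>

lemma acyclic_parent_tree:
  assumes "pre_digraph.cycle (with_proj (parent_tree N par)) c" "3 \<le> length c"
  shows False
proof -
  interpret T: pair_graph "parent_tree N par" by (rule pair_graph_parent_tree)
  let ?E = "parcs (parent_tree N par)"
  obtain u where u: "T.awalk u c u" "distinct (tl (pawalk_verts u c))"
    using assms(1) unfolding T.cycle_def by auto
  define vs L where "vs = pawalk_verts u c" and "L = length c"
  note walk = awalk_imp_successively[OF T.pair_wf_digraph u(1), folded vs_def]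
  have len: "length vs = Suc L"
    using T.length_awalk_verts[of u c] unfolding vs_def L_def by simp
  have L: "3 \<le> L"
    using assms(2) unfolding L_def by simp
  have adj: "(vs ! i, vs ! Suc i) \<in> ?E" if "i < L" for i
    using walk(1) that len by (simp add: successively_conv_nth)
  have ends: "vs ! 0 = u" "vs ! L = u"
    using walk(2,3) len by (simp_all add: hd_conv_nth last_conv_nth flip: length_0_conv)
  \<comment> \<open>Only the tail of the vertex list is distinct, as its head repeats the last
    entry. So distinctness is stated for indices \<open>Suc i\<close>, and index 0 is traded for
    \<open>L\<close> when needed.\<close>
  have inj: "i = j" if "vs ! Suc i = vs ! Suc j" "i < L" "j < L" for i j
    using u(2) that len nth_eq_iff_index_eq[of "tl vs" i j] unfolding vs_def[symmetric]
    by (simp add: nth_tl)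
  define M where "M = Max (set vs)"
  have "set vs \<noteq> {}"
    using len by auto
  then have M: "M \<in> set vs" "\<And>i. i \<le> L \<Longrightarrow> vs ! i \<le> M"
    using len unfolding M_def by (simp_all add: Max_in)
  then obtain i where i: "i \<le> L" "vs ! i = M"
    using len by (metis in_set_conv_nth less_Suc_eq_le)
  have before: "vs ! j = par M" if "Suc j \<le> L" "vs ! Suc j = M" for j
    using parent_tree_below(1)[of M "vs ! j"] adj[of j] M(2)[of j] that by auto
  have after: "vs ! Suc j = par M" if "j < L" "vs ! j = M" for j
    using parent_tree_below(1)[of M "vs ! Suc j"] adj[of j] M(2)[of "Suc j"] that by auto
  show False
  proof (cases "i = 0 \<or> i = L")
    case True
    then have "u = M"
      using i ends by auto
    then have "vs ! Suc 0 = vs ! Suc (L - 2)"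
      using after[of 0] before[of "L - 1"] ends L by (simp add: Suc_diff_le numeral_2_eq_2 Suc_diff_Suc)
    then show False
      using inj[of 0 "L - 2"] L by simp
  next
    case False
    then obtain j where j: "i = Suc j" "Suc j < L"
      using i by (cases i) auto
    have eq: "vs ! j = vs ! Suc (Suc j)"
      using before[of j] after[of i] i j by simp
    show False
    proof (cases j)
      case 0
      then have "vs ! Suc (L - 1) = vs ! Suc 1"
        using eq ends L by simp
      then show False
        using inj[of "L - 1" 1] L by simp
    next
      case (Suc k)
      then show False
        using inj[of k "Suc j"] eq j by simp
    qed
  qed
qed

text \<open>\<open>closed\<close> is the running intersection property: a vertex found in bag
  \<open>t\<close> and in an earlier bag is also in the bag of the parent of \<open>t\<close>. It is
  exactly what \<open>parent_tree_path_closed\<close> asks of the nodes holding that vertex.\<close>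

lemma tree_decomposition_parent_tree:
  assumes "pair_graph G" "0 < N" "(\<Union>t<N. V t) = pverts G"
    and "\<And>u v. (u, v) \<in> parcs G \<Longrightarrow> \<exists>t<N. u \<in> V t \<and> v \<in> V t"
    and closed: "\<And>s t v. s < t \<Longrightarrow> t < N \<Longrightarrow> v \<in> V s \<Longrightarrow> v \<in> V t \<Longrightarrow> v \<in> V (par t)"
  shows "tree_decomposition G (parent_tree N par) V"
proof -
  interpret T: pair_graph "parent_tree N par" by (rule pair_graph_parent_tree)
  have convex: "v \<in> V t'"
    if "t1 < N" "t2 < N" "v \<in> V t1" "v \<in> V t2" and p: "T.apath t1 p t2"
      and t': "t' \<in> set (pawalk_verts t1 p)" for t1 t2 v p t'
  proof -
    have "T.awalk t1 p t2"
      using p by (simp add: T.apath_def)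
    note walk = awalk_imp_successively[OF T.pair_wf_digraph this]
    have "path_in (parcs (parent_tree N par)) (pawalk_verts t1 p)"
      using p walk unfolding path_in_def T.apath_def by (cases p) auto
    then have "set (pawalk_verts t1 p) \<subseteq> {t. t < N \<and> v \<in> V t}"
    proof (rule parent_tree_path_closed[rotated])
      show "hd (pawalk_verts t1 p) \<in> {t. t < N \<and> v \<in> V t}"
        "last (pawalk_verts t1 p) \<in> {t. t < N \<and> v \<in> V t}"
        using walk that by simp_all
      show "par t \<in> {t. t < N \<and> v \<in> V t}"
        if "s \<in> {t. t < N \<and> v \<in> V t}" "t \<in> {t. t < N \<and> v \<in> V t}" "s < t" for s t
        using that closed[of s t v] par[of t] by auto
    qed
    then show ?thesis
      using t' by auto
  qed
  have "undirected_tree (parent_tree N par)"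
    unfolding undirected_tree_def
    using connected_parent_tree[OF \<open>0 < N\<close>] acyclic_parent_tree pair_graph_parent_tree by blast
  show ?thesis
    unfolding tree_decomposition_def pverts_parent_tree awalk_verts_with_proj_eq
  proof (intro conjI allI ballI impI)
    fix u v assume "(u, v) \<in> parcs G"
    then show "\<exists>t\<in>{..<N}. u \<in> V t \<and> v \<in> V t"
      using assms(4) by blast
  next
    fix t1 t2 v p t'
    assume "t1 \<in> {..<N}" "t2 \<in> {..<N}" "v \<in> V t1 \<inter> V t2" "T.apath t1 p t2"
      "t' \<in> set (pawalk_verts t1 p)"
    then show "v \<in> V t'"
      by (intro convex[of t1 t2 v p t']) auto
  qed fact+
qed

end

section \<open>Width and treewidth\<close>

lemma decomposition_width_le_iff:
  assumes "undirected_tree T"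
  shows "decomposition_width T V \<le> k \<longleftrightarrow> (\<forall>t\<in>pverts T. int (card (V t)) \<le> k + 1)"
  using undirected_treeD(2,3)[OF assms] unfolding decomposition_width_def
  by (subst Max_le_iff) (auto simp: algebra_simps)

text \<open>The integers are not well-ordered, so that \<open>LEAST\<close> needs a bound from
  below: widths are at least -1, and minimising \<open>nat (w + 1)\<close> gives the least
  one.\<close>

lemma treewidth_attained:
  fixes T :: "nat pair_pre_digraph"
  assumes "tree_decomposition G T V"
  obtains T' :: "nat pair_pre_digraph" and V' where "tree_decomposition G T' V'"
    "treewidth G = decomposition_width T' V'" "treewidth G \<le> decomposition_width T V"
proof -
  define W where "W w \<longleftrightarrow> (\<exists>(T :: nat pair_pre_digraph) V. tree_decomposition G T V \<and> w = decomposition_width T V)" for w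
  have ge: "- 1 \<le> w" if W: "W w" for w
  proof -
    obtain T :: "nat pair_pre_digraph" and V where "tree_decomposition G T V"
      and w: "w = decomposition_width T V"
      using W unfolding W_def by blast
    then have T: "undirected_tree T"
      unfolding tree_decomposition_def by blast
    obtain t where "t \<in> pverts T"
      using undirected_treeD(3)[OF T] by blast
    then show ?thesis
      using decomposition_width_le_iff[OF T, of V w] w by fastforce
  qed
  have "W (decomposition_width T V)"
    unfolding W_def using assms by blast
  then obtain w where w: "W w" "\<And>w'. W w' \<Longrightarrow> nat (w + 1) \<le> nat (w' + 1)"
    using ex_has_least_nat[of W _ "\<lambda>w. nat (w + 1)"] by metis
  have least: "w \<le> w'" if "W w'" for w'
    using w(2)[OF that] ge[OF that] ge[OF w(1)] by linarith
  have "treewidth G = w"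
    unfolding treewidth_def W_def[symmetric] by (rule Least_equality) (use w least in auto)
  then show ?thesis
    using w(1) least[OF \<open>W (decomposition_width T V)\<close>] that unfolding W_def by blast
qed

section \<open>Upper bounds\<close>

lemma pverts_stacked_prism: "pverts (stacked_prism m n) = {..<m} \<times> {..<n}"
  by (auto simp: stacked_prism_def cartesian_product_def cycle_graph_def path_graph_def)

lemma parcs_stacked_prism:
  "((c, y), (c', y')) \<in> parcs (stacked_prism m n) \<longleftrightarrow>
     c < m \<and> c' < m \<and> y < n \<and> y' < n \<and>
     (y = y' \<and> (c' = Suc c mod m \<or> c = Suc c' mod m) \<or> c = c' \<and> (y' = Suc y \<or> y = Suc y'))"
  by (auto simp: stacked_prism_def cartesian_product_def cycle_graph_def path_graph_def)

lemma sym_parcs_stacked_prism: "sym (parcs (stacked_prism m n))"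
  by (auto simp: sym_def parcs_stacked_prism)

lemma treewidth_le:
  fixes V :: "nat \<Rightarrow> 'a set" and N :: nat
  assumes "pair_graph G" "0 < N" "\<And>i. 0 < i \<Longrightarrow> par i < i" "(\<Union>t<N. V t) = pverts G"
    and "\<And>u v. (u, v) \<in> parcs G \<Longrightarrow> \<exists>t<N. u \<in> V t \<and> v \<in> V t"
    and "\<And>s t v. s < t \<Longrightarrow> t < N \<Longrightarrow> v \<in> V s \<Longrightarrow> v \<in> V t \<Longrightarrow> v \<in> V (par t)"
    and card: "\<And>t. t < N \<Longrightarrow> card (V t) \<le> Suc k"
  shows "treewidth G \<le> int k"
proof -
  have td: "tree_decomposition G (parent_tree N par) V"
    by (rule tree_decomposition_parent_tree) (fact assms)+
  then have "undirected_tree (parent_tree N par)"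
    unfolding tree_decomposition_def by blast
  then have "decomposition_width (parent_tree N par) V \<le> int k"
    using card by (subst decomposition_width_le_iff) fastforce+
  then show ?thesis
    using treewidth_attained[OF td] by (metis order_trans)
qed

text \<open>A bag meeting all members of \<open>F\<close> cannot have at most \<open>k\<close>
  vertices, so the width is at least \<open>k\<close>.\<close>

lemma treewidth_ge_bramble:
  assumes G: "pair_graph G" and F: "\<And>S. S \<in> F \<Longrightarrow> S \<subseteq> pverts G \<and> linked (parcs G) S"
    and touch: "\<And>S S'. S \<in> F \<Longrightarrow> S' \<in> F \<Longrightarrow> touches (parcs G) S S'"
    and avoid: "\<And>X. X \<subseteq> pverts G \<Longrightarrow> card X \<le> k \<Longrightarrow> \<exists>S\<in>F. S \<inter> X = {}"
  shows "int k \<le> treewidth G"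
proof -
  interpret G: pair_graph G by fact
  \<comment> \<open>The one-bag decomposition only serves to show that the minimum is taken over a
    nonempty set.\<close>
  have "tree_decomposition G (parent_tree 1 (\<lambda>i. i - 1)) (\<lambda>_. pverts G)"
  proof (rule tree_decomposition_parent_tree)
    show "\<exists>t<1 :: nat. u \<in> pverts G \<and> v \<in> pverts G" if "(u, v) \<in> parcs G" for u v
      using that G.in_arcsD1 G.in_arcsD2 by (intro exI[of _ 0]) auto
  qed (use G in auto)
  then obtain T :: "nat pair_pre_digraph" and V where td: "tree_decomposition G T V"
    and tw: "treewidth G = decomposition_width T V"
    by (rule treewidth_attained)
  then have tree: "undirected_tree T"
    unfolding tree_decomposition_def by blast
  have "finite F"
    by (rule finite_subset[of _ "Pow (pverts G)"]) (use F in auto)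
  moreover have "F \<noteq> {}"
    using avoid[of "{}"] by auto
  ultimately have "\<exists>t\<in>pverts T. \<forall>S\<in>F. V t \<inter> S \<noteq> {}"
    by (rule bramble_hitting_bag[OF td]) (fact F touch)+
  then obtain t where t: "t \<in> pverts T" "\<forall>S\<in>F. V t \<inter> S \<noteq> {}" ..
  have "V t \<subseteq> pverts G"
    using td t(1) unfolding tree_decomposition_def by blast
  then have "\<not> card (V t) \<le> k"
    using avoid[of "V t"] t(2) by (metis Int_commute)
  moreover have "int (card (V t)) \<le> treewidth G + 1"
    using decomposition_width_le_iff[OF tree, of V "treewidth G"] t(1) tw by simp
  ultimately show ?thesis
    by linarith
qed

text \<open>In the numbering row by row, adjacent vertices differ by at most \<open>m\<close>; the
  bags are windows of \<open>m + 1\<close> consecutive numbers, strung on a path.\<close>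

lemma treewidth_stacked_prism_le_rows:
  assumes "3 \<le> m" "1 \<le> n"
  shows "treewidth (stacked_prism m n) \<le> int m"
proof -
  define idx where "idx = (\<lambda>(c, y). c + m * y)"
  have inj: "inj_on idx ({..<m} \<times> {..<n})"
  proof (rule inj_onI, clarify)
    fix c y c' y' assume *: "c < m" "c' < m" "idx (c, y) = idx (c', y')"
    have "idx (a, b) mod m = a \<and> idx (a, b) div m = b" if "a < m" for a b
      using that by (simp add: idx_def)
    then show "c = c' \<and> y = y'"
      using * by metis
  qed
  have less: "idx (c, y) < n * m" if "c < m" "y < n" for c y
  proof -
    have "idx (c, y) < m * Suc y"
      using that by (simp add: idx_def)
    also have "\<dots> \<le> m * n"
      using that by (intro mult_le_mono2) simp
    finally show ?thesis
      by (simp add: mult.commute)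
  qed
  let ?V = "\<lambda>t. {v \<in> {..<m} \<times> {..<n}. t \<le> idx v \<and> idx v \<le> t + m}"
  show ?thesis
  proof (rule treewidth_le[where N = "n * m" and par = "\<lambda>i. i - 1" and V = ?V])
    show "pair_graph (stacked_prism m n)"
      by (rule pair_graph_stacked_prism) fact
    show "0 < n * m" "\<And>i :: nat. 0 < i \<Longrightarrow> i - 1 < i"
      using assms by simp_all
    have "v \<in> (\<Union>t<n * m. ?V t)" if "v \<in> {..<m} \<times> {..<n}" for v
      using that less[of "fst v" "snd v"] by (intro UN_I[of "idx v"]) auto
    then show "(\<Union>t<n * m. ?V t) = pverts (stacked_prism m n)"
      unfolding pverts_stacked_prism by blast
  next
    fix u v assume uv: "(u, v) \<in> parcs (stacked_prism m n)"
    define t where "t = min (idx u) (idx v)"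
    obtain c y c' y' where eq: "u = (c, y)" "v = (c', y')"
      by (cases u; cases v)
    have b: "c < m" "c' < m" "y < n" "y' < n"
      using uv by (simp_all add: eq parcs_stacked_prism)
    have "Suc a mod m \<le> a + m" for a
      using assms(1) mod_less_divisor[of m "Suc a"] by linarith
    then have "idx u \<le> idx v + m" "idx v \<le> idx u + m"
      using uv b by (auto simp: eq parcs_stacked_prism idx_def)
    moreover have "t < n * m"
      using less[OF b(1,3)] by (simp add: t_def eq)
    ultimately show "\<exists>t<n * m. u \<in> ?V t \<and> v \<in> ?V t"
      using b by (intro exI[of _ t]) (auto simp: t_def eq)
  next
    fix t
    have "card (?V t) = card (idx ` ?V t)"
      by (rule card_image[symmetric]) (rule inj_on_subset[OF inj], auto)
    also have "\<dots> \<le> card {t..t + m}"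
      by (rule card_mono) auto
    finally show "card (?V t) \<le> Suc m"
      by simp
  qed auto
qed

text \<open>In the numbering column by column, adjacent vertices differ by at most \<open>n\<close>,
  except across the wrap-around to column 0. Keeping column 0 in every bag settles those edges and
  adds at most \<open>n\<close> vertices to a window of \<open>n + 1\<close>.\<close>

lemma treewidth_stacked_prism_le_columns:
  assumes "3 \<le> m" "1 \<le> n"
  shows "treewidth (stacked_prism m n) \<le> int (2 * n)"
proof -
  define idx where "idx = (\<lambda>(c, y). y + n * c)"
  have inj: "inj_on idx ({..<m} \<times> {..<n})"
  proof (rule inj_onI, clarify)
    fix c y c' y' assume *: "y < n" "y' < n" "idx (c, y) = idx (c', y')"
    have "idx (a, b) mod n = b \<and> idx (a, b) div n = a" if "b < n" for a b
      using that by (simp add: idx_def)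
    then show "c = c' \<and> y = y'"
      using * by metis
  qed
  have less: "idx (c, y) < m * n" if "c < m" "y < n" for c y
  proof -
    have "idx (c, y) < n * Suc c"
      using that by (simp add: idx_def)
    also have "\<dots> \<le> n * m"
      using that by (intro mult_le_mono2) simp
    finally show ?thesis
      by (simp add: mult.commute)
  qed
  let ?W = "\<lambda>t. {v \<in> {..<m} \<times> {..<n}. t \<le> idx v \<and> idx v \<le> t + n}"
  let ?V = "\<lambda>t. {0} \<times> {..<n} \<union> ?W t"
  show ?thesis
  proof (rule treewidth_le[where N = "m * n" and par = "\<lambda>i. i - 1" and V = ?V])
    show "pair_graph (stacked_prism m n)"
      by (rule pair_graph_stacked_prism) fact
    show "0 < m * n" "\<And>i :: nat. 0 < i \<Longrightarrow> i - 1 < i"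
      using assms by simp_all
    have "v \<in> (\<Union>t<m * n. ?V t)" if "v \<in> {..<m} \<times> {..<n}" for v
      using that less[of "fst v" "snd v"] by (intro UN_I[of "idx v"]) auto
    moreover have "(\<Union>t<m * n. ?V t) \<subseteq> {..<m} \<times> {..<n}"
      using assms by auto
    ultimately show "(\<Union>t<m * n. ?V t) = pverts (stacked_prism m n)"
      unfolding pverts_stacked_prism by blast
  next
    fix u v assume uv: "(u, v) \<in> parcs (stacked_prism m n)"
    obtain c y c' y' where eq: "u = (c, y)" "v = (c', y')"
      by (cases u; cases v)
    have b: "c < m" "c' < m" "y < n" "y' < n"
      using uv by (simp_all add: eq parcs_stacked_prism)
    have W: "w \<in> ?W (idx w) \<and> idx w < m * n" if "w = u \<or> w = v" for w
      using that b less by (auto simp: eq)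
    show "\<exists>t<m * n. u \<in> ?V t \<and> v \<in> ?V t"
    proof (cases "c = 0 \<or> c' = 0")
      case True
      then have "u \<in> {0} \<times> {..<n} \<or> v \<in> {0} \<times> {..<n}"
        using b by (simp add: eq)
      then show ?thesis
        using W[of u] W[of v] by blast
    next
      case False
      define t where "t = min (idx u) (idx v)"
      have "Suc c mod m = Suc c \<or> Suc c mod m = 0" "Suc c' mod m = Suc c' \<or> Suc c' mod m = 0"
        by (simp_all add: mod_Suc b)
      then have "idx u \<le> idx v + n" "idx v \<le> idx u + n"
        using uv b False by (auto simp: eq parcs_stacked_prism idx_def)
      moreover have "t < m * n"
        using less[OF b(1,3)] by (simp add: t_def eq)
      ultimately show ?thesis
        using b by (intro exI[of _ t]) (auto simp: t_def eq)
    qed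
  next
    fix t
    have "card (?W t) = card (idx ` ?W t)"
      by (rule card_image[symmetric]) (rule inj_on_subset[OF inj], auto)
    also have "\<dots> \<le> card {t..t + n}"
      by (rule card_mono) auto
    finally have "card (?W t) \<le> Suc n"
      by simp
    moreover have "card ({0 :: nat} \<times> {..<n}) = n"
      by simp
    ultimately show "card (?V t) \<le> Suc (2 * n)"
      using card_Un_le[of "{0} \<times> {..<n}" "?W t"] by linarith
  qed auto
qed

lemma treewidth_cube_le: "treewidth (stacked_prism 4 2) \<le> 3"
proof -
  \<comment> \<open>Leaf \<open>t\<close> is the closed neighbourhood of
    \<open>(t - 1, t mod 2)\<close>, a vertex of odd coordinate sum. Its three neighbours lie in the
    centre, the class of even sum, so two leaves share only vertices of the centre.\<close>
  define V where "V t = (if t = 0 then {(0, 0), (1, 1), (2, 0), (3, 1)}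
    else {(t - 1, t mod 2), (t mod 4, t mod 2), ((t + 2) mod 4, t mod 2), (t - 1, (t + 1) mod 2)})"
    for t :: nat
  have V: "V 0 = {(0, 0), (1, 1), (2, 0), (3, 1)}" "V (Suc 0) = {(0, 1), (1, 1), (3, 1), (0, 0)}"
    "V 2 = {(1, 0), (2, 0), (0, 0), (1, 1)}" "V 3 = {(2, 1), (3, 1), (1, 1), (2, 0)}"
    "V 4 = {(3, 0), (0, 0), (2, 0), (3, 1)}"
    by (simp_all add: V_def)
  have "treewidth (stacked_prism 4 2) \<le> int 3"
  proof (rule treewidth_le[where N = 5 and par = "\<lambda>_. 0" and V = V])
    show "pair_graph (stacked_prism 4 2)"
      by (rule pair_graph_stacked_prism) simp
    have "{..<5 :: nat} = {0, 1, 2, 3, 4}" "{..<4 :: nat} = {0, 1, 2, 3}" "{..<2 :: nat} = {0, 1}"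
      by auto
    then show "(\<Union>t<5. V t) = pverts (stacked_prism 4 2)"
      unfolding pverts_stacked_prism by (simp only: V One_nat_def UN_insert UN_empty) auto
  next
    fix u v assume uv: "(u, v) \<in> parcs (stacked_prism 4 2)"
    obtain c y c' y' where eq: "u = (c, y)" "v = (c', y')"
      by (cases u; cases v)
    have "c < 4" "c' < 4" "y < 2" "y' < 2"
      and rel: "y = y' \<and> (c' = Suc c mod 4 \<or> c = Suc c' mod 4) \<or> c = c' \<and> (y' = Suc y \<or> y = Suc y')"
      using uv unfolding eq parcs_stacked_prism by blast+
    then have "c \<in> {0, 1, 2, 3}" "c' \<in> {0, 1, 2, 3}" "y \<in> {0, 1}" "y' \<in> {0, 1}"
      by auto
    then have "\<exists>t\<in>{0, 1, 2, 3, 4}. (c, y) \<in> V t \<and> (c', y') \<in> V t"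
      using rel by (elim insertE emptyE) (simp_all add: V)
    then show "\<exists>t<5. u \<in> V t \<and> v \<in> V t"
      unfolding eq by (elim bexE) (intro exI conjI; auto)
  next
    fix s t v assume st: "s < t" "t < 5" and v: "v \<in> V s" "v \<in> V t"
    have "s \<in> {0, 1, 2, 3}" "t \<in> {1, 2, 3, 4}"
      using st by auto
    then show "v \<in> V 0"
      using st(1) v by (elim insertE emptyE) (auto simp: V)
  next
    fix t :: nat assume "t < 5"
    then have "t \<in> {0, 1, 2, 3, 4}"
      by auto
    then show "card (V t) \<le> Suc 3"
      by (elim insertE emptyE) (simp_all add: V)
  qed simp_all
  then show ?thesis
    by simp
qed

section \<open>The bramble\<close>

definition row :: "('a \<times> 'b) set \<Rightarrow> 'b \<Rightarrow> 'a set" where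
  "row S i = {c. (c, i) \<in> S}"

definition col :: "('a \<times> 'b) set \<Rightarrow> 'a \<Rightarrow> 'b set" where
  "col S c = {i. (c, i) \<in> S}"

definition cycle_adj :: "nat \<Rightarrow> nat \<Rightarrow> nat \<Rightarrow> bool" where
  "cycle_adj m c d \<longleftrightarrow> c < m \<and> d < m \<and> (d = Suc c mod m \<or> c = Suc d mod m)"

lemma cycle_adj_sym: "cycle_adj m c d \<Longrightarrow> cycle_adj m d c"
  unfolding cycle_adj_def by blast

lemma cycle_adj_less:
  assumes "c < d"
  shows "cycle_adj m c d \<longleftrightarrow> d < m \<and> (d = Suc c \<or> c = 0 \<and> d = m - 1)"
  using assms unfolding cycle_adj_def by (auto simp: mod_Suc)

lemma in_row [simp]: "c \<in> row S i \<longleftrightarrow> (c, i) \<in> S"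
  and in_col [simp]: "i \<in> col S c \<longleftrightarrow> (c, i) \<in> S"
  by (simp_all add: row_def col_def)

lemma row_subset: "S \<subseteq> A \<times> B \<Longrightarrow> row S i \<subseteq> A"
  and col_subset: "S \<subseteq> A \<times> B \<Longrightarrow> col S c \<subseteq> B"
  by (auto simp: row_def col_def)

lemma card_eq_sum_row:
  assumes "finite A" "finite B" "S \<subseteq> A \<times> B"
  shows "card S = (\<Sum>i\<in>B. card (row S i))"
proof -
  have "finite (row S i)" for i
    using row_subset[OF assms(3)] assms(1) finite_subset by blast
  then have "card (Sigma B (row S)) = (\<Sum>i\<in>B. card (row S i))"
    using assms(2) by (intro card_SigmaI) auto
  moreover have "S = prod.swap ` Sigma B (row S)"
    using assms(3) by (force simp: row_def)
  ultimately show ?thesis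
    by (metis card_image inj_swap inj_on_subset subset_UNIV)
qed

lemma card_eq_sum_col:
  assumes "finite A" "finite B" "S \<subseteq> A \<times> B"
  shows "card S = (\<Sum>c\<in>A. card (col S c))"
proof -
  have "finite (col S c)" for c
    using col_subset[OF assms(3)] assms(2) finite_subset by blast
  then have "card (Sigma A (col S)) = (\<Sum>c\<in>A. card (col S c))"
    using assms(1) by (intro card_SigmaI) auto
  moreover have "S = Sigma A (col S)"
    using assms(3) by (auto simp: col_def)
  ultimately show ?thesis
    by metis
qed

section \<open>Separated sets on a cycle and on a path\<close>

lemma cycle_closed_eq:
  assumes "S \<subseteq> {..<m}" "S \<noteq> {}" "\<And>x. x \<in> S \<Longrightarrow> Suc x mod m \<in> S"
  shows "S = {..<m}"
proof -
  obtain x where x: "x \<in> S"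
    using assms(2) by blast
  have "(x + k) mod m \<in> S" for k
  proof (induction k)
    case 0
    then show ?case
      using x assms(1) by auto
  next
    case (Suc k)
    then show ?case
      using assms(3)[OF Suc.IH] by (simp add: mod_Suc_eq)
  qed
  moreover have "z = (x + (m - x + z)) mod m" if "z < m" for z
    using x assms(1) that by auto
  ultimately have "{..<m} \<subseteq> S"
    by (metis lessThan_iff subsetI)
  then show ?thesis
    using assms(1) by blast
qed

text \<open>Going around the cycle, one leaves each of the two sets at least once.\<close>

lemma cycle_separation:
  assumes "S \<subseteq> {..<m}" "T \<subseteq> {..<m}" "S \<noteq> {}" "T \<noteq> {}" "S \<inter> T = {}"
    and sep: "\<And>x y. x \<in> S \<Longrightarrow> y \<in> T \<Longrightarrow> \<not> cycle_adj m x y"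
  shows "card S + card T + 2 \<le> m"
proof -
  let ?f = "\<lambda>x. Suc x mod m"
  obtain x where x: "x \<in> S" "?f x \<notin> S"
    using cycle_closed_eq[of S m] assms by blast
  obtain y where y: "y \<in> T" "?f y \<notin> T"
    using cycle_closed_eq[of T m] assms by blast
  have less: "x < m" "y < m" "x \<noteq> y"
    using x y assms by auto
  \<comment> \<open>The two exits lead to different vertices because the successor map is injective;
    thus two vertices are lost, not one.\<close>
  then have ne: "?f x \<noteq> ?f y"
    by (auto simp: mod_Suc split: if_splits)
  have "?f x < m" "?f y < m"
    using less(1) by simp_all
  moreover have "?f x \<notin> T" "?f y \<notin> S"
    using sep[OF x(1), of "?f x"] sep[OF _ y(1), of "?f y"] less \<open>?f x < m\<close> \<open>?f y < m\<close>
    unfolding cycle_adj_def by blast+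
  ultimately have "S \<union> T \<union> {?f x, ?f y} \<subseteq> {..<m}" "(S \<union> T) \<inter> {?f x, ?f y} = {}"
    using x y assms by auto
  moreover have "finite S" "finite T"
    using assms finite_subset by blast+
  ultimately have "card (S \<union> T \<union> {?f x, ?f y}) = card S + card T + 2"
    using assms(5) ne by (simp add: card_Un_disjoint del: Un_insert_right)
  then show ?thesis
    using card_mono[OF _ \<open>S \<union> T \<union> {?f x, ?f y} \<subseteq> {..<m}\<close>] by simp
qed

text \<open>On a path only one lost vertex is forced: if the two sets covered everything, membership
  in \<open>S\<close> would spread from 0 to all of the path.\<close>

lemma path_separation:
  assumes "S \<subseteq> {..<n}" "T \<subseteq> {..<n}" "S \<noteq> {}" "T \<noteq> {}" "S \<inter> T = {}"
    and sep: "\<And>y. Suc y \<in> T \<Longrightarrow> y \<notin> S" "\<And>y. Suc y \<in> S \<Longrightarrow> y \<notin> T"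
  shows "card S + card T < n"
proof -
  have "S \<union> T \<noteq> {..<n}"
  proof
    assume eq: "S \<union> T = {..<n}"
    have iff: "y \<in> S \<longleftrightarrow> 0 \<in> S" if "y < n" for y
      using that
    proof (induction y)
      case (Suc y)
      then have "y \<in> S \<union> T" "Suc y \<in> S \<union> T"
        using eq by auto
      then show ?case
        using Suc sep[of y] assms(5) by auto
    qed simp
    obtain s t where "s \<in> S" "t \<in> T"
      using assms by blast
    then show False
      using iff[of s] iff[of t] assms(1,2,5) by auto
  qed
  then have "card (S \<union> T) < card {..<n}"
    using assms(1,2) by (intro psubset_card_mono) auto
  moreover have "finite S" "finite T"
    using assms finite_subset by blast+
  ultimately show ?thesis
    using assms(5) by (simp add: card_Un_disjoint)
qed

locale prism =
  fixes m n :: nat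
  assumes m3: "3 \<le> m"
begin

abbreviation "E \<equiv> parcs (stacked_prism m n)"

lemma sym_E: "sym E"
  by (rule sym_parcs_stacked_prism)

lemma row_edge: "cycle_adj m c d \<Longrightarrow> i < n \<Longrightarrow> ((c, i), (d, i)) \<in> E"
  unfolding cycle_adj_def parcs_stacked_prism by blast

lemma col_edge: "c < m \<Longrightarrow> Suc i < n \<Longrightarrow> ((c, i), (c, Suc i)) \<in> E"
  unfolding parcs_stacked_prism by simp

lemma not_touches_rows:
  assumes "\<not> touches E S T" "S \<subseteq> {..<m} \<times> {..<n}" "T \<subseteq> {..<m} \<times> {..<n}"
    and "row S i \<noteq> {}" "row T i \<noteq> {}" "i < n"
  shows "card (row S i) + card (row T i) + 2 \<le> m"
proof (rule cycle_separation)
  show "row S i \<inter> row T i = {}"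
    using assms(1) unfolding touches_def by auto
  show "\<not> cycle_adj m x y" if "x \<in> row S i" "y \<in> row T i" for x y
    using assms(1) row_edge[of x y i] that \<open>i < n\<close> unfolding touches_def by auto
qed (simp_all add: assms row_subset[OF assms(2)] row_subset[OF assms(3)])

lemma not_touches_cols:
  assumes "\<not> touches E S T" "S \<subseteq> {..<m} \<times> {..<n}" "T \<subseteq> {..<m} \<times> {..<n}"
    and "col S c \<noteq> {}" "col T c \<noteq> {}" "c < m"
  shows "card (col S c) + card (col T c) < n"
proof (rule path_separation)
  have nt: "(u, v) \<notin> E" "(v, u) \<notin> E" if "u \<in> S" "v \<in> T" for u v
    using assms(1) that symD[OF sym_E] unfolding touches_def by blast+
  show "col S c \<inter> col T c = {}"
    using assms(1) unfolding touches_def by auto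
  show "y \<notin> col S c" if "Suc y \<in> col T c" for y
    using nt(1)[of "(c, y)" "(c, Suc y)"] col_edge[of c y] that assms(3,6) by auto
  show "y \<notin> col T c" if "Suc y \<in> col S c" for y
    using nt(2)[of "(c, Suc y)" "(c, y)"] col_edge[of c y] that assms(2,6) by auto
qed (simp_all add: assms col_subset[OF assms(2)] col_subset[OF assms(3)])

text \<open>The thresholds are half of what remains when two vertices are removed from each row, respectively
  one from each column. In case of equality, the last condition chooses one of two complementary
  sets.\<close>

definition row_bramble :: "(nat \<times> nat) set \<Rightarrow> bool" where
  "row_bramble S \<longleftrightarrow> S \<subseteq> {..<m} \<times> {..<n} \<and> linked E S \<and> (\<forall>i<n. row S i \<noteq> {}) \<and>
     ((\<exists>i<n. m \<le> card (row S i) + 2) \<or> n * (m - 2) < 2 * card S \<or>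
      2 * card S = n * (m - 2) \<and> (\<exists>j. (j, 0) \<in> S \<and> (\<forall>j'<j. touches E S {(j', 0)})))"

definition col_bramble :: "(nat \<times> nat) set \<Rightarrow> bool" where
  "col_bramble S \<longleftrightarrow> S \<subseteq> {..<m} \<times> {..<n} \<and> linked E S \<and> (\<exists>i<n. m \<le> card (row S i) + 2) \<and>
     (m * (n - 1) < 2 * card S \<or> 2 * card S = m * (n - 1) \<and> m \<le> card (row S 0) + 2)"

section \<open>Members of the bramble touch pairwise\<close>

lemma card_rows: "S \<subseteq> {..<m} \<times> {..<n} \<Longrightarrow> card S = (\<Sum>i<n. card (row S i))"
  by (rule card_eq_sum_row) auto

lemma card_cols: "S \<subseteq> {..<m} \<times> {..<n} \<Longrightarrow> card S = (\<Sum>c<m. card (col S c))"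
  by (rule card_eq_sum_col) auto

lemma large_row_nonempty: "m \<le> card (row S i) + 2 \<Longrightarrow> row S i \<noteq> {}"
  using m3 by auto

text \<open>Otherwise they would fill at most \<open>m - 2\<close> places of each row, each of them
  at least one; so neither has a large row, and both have exactly half of
  \<open>n * (m - 2)\<close>. By the tie-break, the set with the larger column index then touches
  the chosen vertex \<open>(j, 0)\<close> or \<open>(k, 0)\<close> of the other, and equal indices
  give a common vertex.\<close>

lemma row_bramble_touches_row_bramble:
  assumes S: "row_bramble S" and T: "row_bramble T"
  shows "touches E S T"
proof (rule ccontr)
  assume nt: "\<not> touches E S T"
  have sub: "S \<subseteq> {..<m} \<times> {..<n}" "T \<subseteq> {..<m} \<times> {..<n}"
    and ne: "\<And>i. i < n \<Longrightarrow> row S i \<noteq> {}" "\<And>i. i < n \<Longrightarrow> row T i \<noteq> {}"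
    using S T unfolding row_bramble_def by blast+
  have le: "card (row S i) + card (row T i) + 2 \<le> m" if "i < n" for i
    by (rule not_touches_rows[OF nt sub]) (use ne that in auto)
  have "0 < card (row S i)" "0 < card (row T i)" if "i < n" for i
    using ne[OF that] row_subset[OF sub(1), of i] row_subset[OF sub(2), of i]
    by (auto simp: card_gt_0_iff intro: finite_subset)
  then have small: "\<not> m \<le> card (row S i) + 2" "\<not> m \<le> card (row T i) + 2" if "i < n" for i
    using le[OF that] that by fastforce+
  have "card S + card T = (\<Sum>i<n. card (row S i) + card (row T i))"
    by (simp add: card_rows sub sum.distrib)
  also have "\<dots> \<le> (\<Sum>i<n. m - 2)"
    by (rule sum_mono) (use le in fastforce)
  finally have "2 * card S + 2 * card T \<le> 2 * (n * (m - 2))"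
    by simp
  moreover have "n * (m - 2) \<le> 2 * card S" "n * (m - 2) \<le> 2 * card T"
    using S T small unfolding row_bramble_def by force+
  ultimately have "2 * card S = n * (m - 2)" "2 * card T = n * (m - 2)"
    by simp_all
  then obtain j k where j: "(j, 0) \<in> S" "\<forall>j'<j. touches E S {(j', 0)}"
    and k: "(k, 0) \<in> T" "\<forall>k'<k. touches E T {(k', 0)}"
    using S T small unfolding row_bramble_def by (metis less_irrefl)
  show False
  proof (rule linorder_cases[of j k])
    assume "j < k"
    then have "touches E {(j, 0)} T"
      using k(2) touches_sym[OF sym_E] by blast
    then have "touches E S T"
      using j(1) unfolding touches_def by blast
    then show False
      using nt by blast
  next
    assume "j = k"
    then show False
      using nt j(1) k(1) unfolding touches_def by blast
  next
    assume "k < j"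
    then have "touches E S {(k, 0)}"
      using j(2) by blast
    then have "touches E S T"
      using k(1) unfolding touches_def by blast
    then show False
      using nt by blast
  qed
qed

text \<open>\<open>T\<close> has a row with at least \<open>m - 2\<close> vertices, and
  \<open>S\<close> meets that row; separated sets within a row leave no space for this.\<close>

lemma row_bramble_touches_col_bramble:
  assumes S: "row_bramble S" and T: "col_bramble T"
  shows "touches E S T"
proof (rule ccontr)
  assume nt: "\<not> touches E S T"
  obtain i where i: "i < n" "m \<le> card (row T i) + 2"
    using T unfolding col_bramble_def by blast
  have sub: "S \<subseteq> {..<m} \<times> {..<n}" "T \<subseteq> {..<m} \<times> {..<n}" and ne: "row S i \<noteq> {}"
    using S T i(1) unfolding row_bramble_def col_bramble_def by blast+
  have "card (row S i) + card (row T i) + 2 \<le> m"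
    by (rule not_touches_rows[OF nt sub ne large_row_nonempty[OF i(2)] i(1)])
  moreover have "0 < card (row S i)"
    using ne row_subset[OF sub(1), of i] by (auto simp: card_gt_0_iff intro: finite_subset)
  ultimately show False
    using i(2) by linarith
qed

text \<open>A vertex and its two neighbours are three different vertices, while at most two are
  missing from the row.\<close>

lemma large_row_dominates:
  assumes "m \<le> card (row S i) + 2" "S \<subseteq> {..<m} \<times> {..<n}" "c < m" "c \<notin> row S i"
  shows "\<exists>d\<in>row S i. cycle_adj m c d"
proof (rule ccontr)
  assume no: "\<not> ?thesis"
  define d where "d = (if c = 0 then m - 1 else c - 1)"
  have adj: "cycle_adj m c (Suc c mod m)" "cycle_adj m c d"
    using assms(3) m3 unfolding cycle_adj_def d_def by (auto simp: mod_Suc)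
  have ne: "Suc c mod m \<noteq> c" "d \<noteq> c" "Suc c mod m \<noteq> d"
    using assms(3) m3 unfolding d_def by (auto simp: mod_Suc)
  have "row S i \<subseteq> {..<m} - {c, Suc c mod m, d}"
    using no adj assms(4) row_subset[OF assms(2), of i] by auto
  then have "card (row S i) \<le> card ({..<m} - {c, Suc c mod m, d})"
    by (rule card_mono[rotated]) simp
  also have "\<dots> = m - 3"
    using ne adj unfolding cycle_adj_def by (subst card_Diff_subset) auto
  finally show False
    using assms(1) m3 by linarith
qed

text \<open>A column met by both sets loses a vertex to the gap. A column missed by one is not full
  in the other either, because the large row of the former has a vertex next to it. So both have
  exactly half of \<open>m * (n - 1)\<close>, and the tie-break puts at least \<open>m - 2\<close>
  vertices of each into row 0, too many for \<open>3 \<le> m\<close>.\<close>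

lemma col_bramble_touches_col_bramble:
  assumes S: "col_bramble S" and T: "col_bramble T"
  shows "touches E S T"
proof (rule ccontr)
  assume nt: "\<not> touches E S T"
  have nt': "\<not> touches E T S"
    using nt touches_sym[OF sym_E] by blast
  have sub: "S \<subseteq> {..<m} \<times> {..<n}" "T \<subseteq> {..<m} \<times> {..<n}"
    using S T unfolding col_bramble_def by blast+
  have empty: "card (col B c) < n"
    if nt: "\<not> touches E A B" and A: "A \<subseteq> {..<m} \<times> {..<n}" "i < n" "m \<le> card (row A i) + 2"
      and B: "B \<subseteq> {..<m} \<times> {..<n}" and c: "c < m" "col A c = {}" for A B i c
  proof -
    have "c \<notin> row A i"
      using c(2) by auto
    then obtain d where d: "(d, i) \<in> A" "cycle_adj m c d"
      using large_row_dominates[OF A(3,1) c(1)] by auto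
    then have "(c, i) \<notin> B"
      using nt row_edge[OF cycle_adj_sym[OF d(2)] A(2)] unfolding touches_def by blast
    then have "col B c \<subset> {..<n}"
      using col_subset[OF B, of c] A(2) by auto
    then have "card (col B c) < card {..<n}"
      by (intro psubset_card_mono) auto
    then show ?thesis
      by simp
  qed
  obtain i k where i: "i < n" "m \<le> card (row S i) + 2" and k: "k < n" "m \<le> card (row T k) + 2"
    using S T unfolding col_bramble_def by blast
  have "card (col S c) + card (col T c) < n" if "c < m" for c
  proof -
    consider "col S c = {}" | "col T c = {}" | "col S c \<noteq> {}" "col T c \<noteq> {}"
      by blast
    then show ?thesis
    proof cases
      case 1
      then show ?thesis
        using empty[OF nt sub(1) i sub(2) that] by simp
    next
      case 2
      then show ?thesis
        using empty[OF nt' sub(2) k sub(1) that] by simp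
    next
      case 3
      then show ?thesis
        by (intro not_touches_cols[OF nt sub] that)
    qed
  qed
  then have le: "card (col S c) + card (col T c) \<le> n - 1" if "c < m" for c
    using that by fastforce
  have "card S + card T = (\<Sum>c<m. card (col S c) + card (col T c))"
    by (simp add: card_cols sub sum.distrib)
  also have "\<dots> \<le> (\<Sum>c<m. n - 1)"
    by (rule sum_mono) (use le in auto)
  finally have "2 * card S + 2 * card T \<le> 2 * (m * (n - 1))"
    by simp
  then have large: "m \<le> card (row S 0) + 2" "m \<le> card (row T 0) + 2"
    using S T unfolding col_bramble_def by linarith+
  have "card (row S 0) + card (row T 0) + 2 \<le> m"
    by (rule not_touches_rows[OF nt sub large[THEN large_row_nonempty]]) (use i(1) in simp)
  then show False
    using large m3 by linarith
qed

end

section \<open>Two removed vertices in each row\<close>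

lemma sum_lessThan_split:
  fixes f :: "nat \<Rightarrow> nat"
  assumes "e \<le> m"
  shows "(\<Sum>k<m. f k) = (\<Sum>k<e. f k) + (\<Sum>k<m - e. f (e + k))"
proof -
  have "(\<Sum>k<e + d. f k) = (\<Sum>k<e. f k) + (\<Sum>k<d. f (e + k))" for d
    by (induction d) simp_all
  from this[of "m - e"] show ?thesis
    using assms by simp
qed

text \<open>By convexity the extreme case is that one of the summands is 1.\<close>

lemma square_sum_bound:
  fixes a b :: nat
  assumes "0 < a" "0 < b"
  shows "a\<^sup>2 + b\<^sup>2 \<le> 1 + (a + b - 1)\<^sup>2"
proof -
  obtain a' b' where "a = Suc a'" "b = Suc b'"
    using assms by (metis Suc_pred)
  then show ?thesis
    by (simp add: power2_eq_square algebra_simps)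
qed

text \<open>The extremal sequence is that of the odd numbers.\<close>

lemma sum_growth_two_bound:
  fixes f :: "nat \<Rightarrow> nat"
  assumes "f 0 \<le> 1" "\<And>k. Suc k < a \<Longrightarrow> f (Suc k) \<le> f k + 2"
  shows "(\<Sum>k<a. f k) \<le> a\<^sup>2"
proof -
  have "f k \<le> 2 * k + 1" if "k < a" for k
    using that
  proof (induction k)
    case (Suc k)
    then show ?case
      using assms(2)[of k] by simp
  qed (use assms in simp)
  then have "(\<Sum>k<a. f k) \<le> (\<Sum>k<a. 2 * k + 1)"
    by (intro sum_mono) simp
  also have "\<dots> = a\<^sup>2"
    by (induction a) (simp_all add: power2_eq_square)
  finally show ?thesis .
qed

text \<open>The function stays below the tent \<open>min k (e - k)\<close>, whose area is about a
  quarter of the square.\<close>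

lemma sum_lipschitz_zero_ends:
  fixes g :: "nat \<Rightarrow> nat"
  assumes "g 0 = 0" "g e = 0"
    and up: "\<And>k. k < e \<Longrightarrow> g (Suc k) \<le> g k + 1" and down: "\<And>k. k < e \<Longrightarrow> g k \<le> g (Suc k) + 1"
  shows "4 * (\<Sum>k<e. g k) \<le> e\<^sup>2"
proof -
  have left: "g k \<le> k" if "k \<le> e" for k
    using that
  proof (induction k)
    case (Suc k)
    then show ?case
      using up[of k] by simp
  qed (use assms in simp)
  have right: "g (e - k) \<le> k" if "k \<le> e" for k
    using that
  proof (induction k)
    case (Suc k)
    then show ?case
      using down[of "e - Suc k"] by (simp add: Suc_diff_Suc)
  qed (use assms in simp)
  have "g k \<le> min k (e - k)" if "k < e" for k
    using left[of k] right[of "e - k"] that by simp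
  then have "(\<Sum>k<e. g k) \<le> (\<Sum>k<e. min k (e - k))"
    by (intro sum_mono) simp
  moreover have "4 * (\<Sum>k<e. min k (e - k)) \<le> e\<^sup>2"
  proof (induction e rule: induct_nat_012)
    case (ge2 e)
    \<comment> \<open>Dropping the zero term at the left end and shifting the index lowers the tent
      by one.\<close>
    have "(\<Sum>k<Suc (Suc e). min k (Suc (Suc e) - k)) = (\<Sum>k<Suc e. Suc (min k (e - k)))"
      by (subst sum.lessThan_Suc_shift) (auto simp: min_def intro!: sum.cong)
    also have "\<dots> = Suc e + (\<Sum>k<e. min k (e - k))"
      by (simp add: sum_Suc)
    finally show ?case
      using ge2.IH(1) by (simp add: power2_eq_square)
  qed simp_all
  ultimately show ?thesis
    by linarith
qed

lemma UN_shift_atMost: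
  fixes a b :: nat
  assumes "a \<le> b"
  shows "(\<Union>d\<le>b - a. f (a + d)) = (\<Union>x\<in>{a..b}. f x)"
proof -
  have "{a..b} = (+) a ` {..b - a}"
    using assms by (simp add: atMost_atLeast0 image_add_atLeastAtMost)
  then show ?thesis
    by simp
qed

context prism
begin

abbreviation "vertices \<equiv> {..<m} \<times> {..<n}"

lemma row_edge_Suc: "Suc c < m \<Longrightarrow> i < n \<Longrightarrow> ((c, i), (Suc c, i)) \<in> E"
  by (rule row_edge) (auto simp: cycle_adj_def)

lemma row_edge_wrap: "i < n \<Longrightarrow> ((m - 1, i), (0, i)) \<in> E"
  by (rule row_edge) (use m3 in \<open>auto simp: cycle_adj_def\<close>)

section \<open>Connected pieces of rows and columns\<close>

lemma linked_horizontal: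
  assumes "i < n" "b < m"
  shows "linked E ({a..b} \<times> {i})"
proof (cases "a \<le> b")
  case True
  have "linked E (\<Union>d\<le>b - a. {(a + d, i)})"
    by (rule linked_UN_chain[OF sym_E])
      (use assms row_edge_Suc in \<open>auto simp: touches_def\<close>)
  moreover have "(\<Union>d\<le>b - a. {(a + d, i)}) = {a..b} \<times> {i}"
    using UN_shift_atMost[OF True, of "\<lambda>x. {(x, i)}"] by auto
  ultimately show ?thesis
    by simp
qed simp

lemma linked_vertical:
  assumes "c < m" "b < n"
  shows "linked E ({c} \<times> {a..b})"
proof (cases "a \<le> b")
  case True
  have "linked E (\<Union>d\<le>b - a. {(c, a + d)})"
    by (rule linked_UN_chain[OF sym_E])
      (use assms col_edge in \<open>auto simp: touches_def\<close>)
  moreover have "(\<Union>d\<le>b - a. {(c, a + d)}) = {c} \<times> {a..b}"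
    using UN_shift_atMost[OF True, of "\<lambda>y. {(c, y)}"] by auto
  ultimately show ?thesis
    by simp
qed simp

lemma linked_horizontal_between:
  assumes "i < n" "q \<le> m"
  shows "linked E ({p<..<q} \<times> {i})"
proof (cases q)
  case (Suc b)
  then have "{p<..<q} = {Suc p..b}"
    by auto
  then show ?thesis
    using linked_horizontal[of i b "Suc p"] assms Suc by simp
qed simp

lemma linked_vertical_below: "c < m \<Longrightarrow> h \<le> n \<Longrightarrow> linked E ({c} \<times> {..<h})"
proof (cases h)
  case (Suc b)
  assume "c < m" "h \<le> n"
  moreover have "{..<h} = {0..b}"
    using Suc by auto
  ultimately show ?thesis
    using linked_vertical[of c b 0] Suc by simp
qed simp

lemma linked_vertical_above: "c < m \<Longrightarrow> linked E ({c} \<times> {h<..<n})"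
proof (cases n)
  case (Suc b)
  assume "c < m"
  moreover have "{h<..<n} = {Suc h..b}"
    using Suc by auto
  ultimately show ?thesis
    using linked_vertical[of c b "Suc h"] Suc by simp
qed simp

text \<open>The outer arc passes through the edge between \<open>m - 1\<close> and 0, unless one of
  its two parts is empty.\<close>

lemma linked_horizontal_outside:
  assumes "i < n" "p < m" "q < m"
  shows "linked E (({..<p} \<union> {q<..<m}) \<times> {i})"
proof -
  have R: "linked E ({q<..<m} \<times> {i})"
    by (rule linked_horizontal_between) (use assms in simp_all)
  have L: "linked E ({..<p} \<times> {i})"
  proof (cases p)
    case (Suc b)
    then have "{..<p} = {0..b}"
      by auto
    then show ?thesis
      using linked_horizontal[of i b 0] assms Suc by simp
  qed simp
  consider "p = 0" | "Suc q = m" | "0 < p" "Suc q < m"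
    using assms by linarith
  then show ?thesis
  proof cases
    case 1
    then show ?thesis
      using R by simp
  next
    case 2
    then have "{q<..<m} = {}"
      by auto
    then show ?thesis
      using L by simp
  next
    case 3
    then have "(m - 1, i) \<in> {q<..<m} \<times> {i}" "(0, i) \<in> {..<p} \<times> {i}"
      by auto
    then have "touches E ({q<..<m} \<times> {i}) ({..<p} \<times> {i})"
      using row_edge_wrap[OF assms(1)] unfolding touches_def by blast
    then have "linked E ({q<..<m} \<times> {i} \<union> {..<p} \<times> {i})"
      by (rule linked_Un[OF sym_E R L])
    then show ?thesis
      by (simp add: Sigma_Un_distrib1 Un_commute)
  qed
qed

text \<open>A cycle minus at most one vertex is connected, so \<open>K\<close> can be enlarged by
  \<open>m - 1\<close> vertices of row \<open>i\<close>, which makes that row large.\<close>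

lemma row_bramble_if_small_row:
  assumes K: "K \<subseteq> vertices" "linked E K" "K \<inter> X = {}" "\<And>i. i < n \<Longrightarrow> row K i \<noteq> {}"
    and X: "X \<subseteq> vertices" "i < n" "card (row X i) \<le> 1"
  shows "\<exists>S. row_bramble S \<and> S \<inter> X = {}"
proof -
  have "finite (row X i)"
    using row_subset[OF X(1), of i] finite_subset by blast
  \<comment> \<open>If nothing is removed from the row, 0 stands in for \<open>p\<close>; leaving
    out one vertex more does no harm.\<close>
  then obtain p where p: "p < m" "row X i \<subseteq> {p}"
    using X(3) row_subset[OF X(1), of i] m3 card_le_Suc0_iff_eq[of "row X i"]
    by (cases "row X i = {}") (auto intro: that[of 0])
  define A where "A = ({..<p} \<union> {p<..<m}) \<times> {i}"
  have A: "A = ({..<m} - {p}) \<times> {i}"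
    using p(1) unfolding A_def by auto
  have "linked E A"
    unfolding A_def by (rule linked_horizontal_outside) (use p X in auto)
  moreover have "touches E K A"
  proof -
    obtain c where "c \<in> row K i"
      using K(4)[OF X(2)] by blast
    then have c: "(c, i) \<in> K" "c < m"
      using row_subset[OF K(1), of i] by auto
    show ?thesis
    proof (cases "c = p")
      case True
      have "Suc p mod m < m" "Suc p mod m \<noteq> p"
        using m3 p(1) by (auto simp: mod_Suc)
      moreover have "((p, i), (Suc p mod m, i)) \<in> E"
        by (rule row_edge) (use p(1) X(2) m3 in \<open>auto simp: cycle_adj_def\<close>)
      ultimately show ?thesis
        using c True unfolding touches_def A by blast
    next
      case False
      then show ?thesis
        using c unfolding touches_def A by blast
    qed
  qed
  ultimately have "linked E (K \<union> A)"
    by (intro linked_Un[OF sym_E K(2)])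
  moreover have "A \<inter> X = {}"
    using p(2) unfolding A by auto
  moreover have "m \<le> card (row (K \<union> A) i) + 2"
  proof -
    have "card ({..<m} - {p}) \<le> card (row (K \<union> A) i)"
      using row_subset[of "K \<union> A" "{..<m}" "{..<n}" i] K(1) X(2) unfolding A
      by (intro card_mono) (auto intro: finite_subset)
    then show ?thesis
      using p(1) by simp
  qed
  moreover have "row (K \<union> A) k \<noteq> {}" if "k < n" for k
    using K(4)[OF that] by auto
  moreover have "K \<union> A \<subseteq> vertices"
    using K(1) X(2) unfolding A by auto
  ultimately show ?thesis
    using K(3) X(2) unfolding row_bramble_def by (intro exI[of _ "K \<union> A"]) blast
qed

text \<open>A cycle with two vertices removed consists of two arcs.\<close>

lemma two_cut_row:
  assumes S: "S \<subseteq> W" "\<And>C. linked E C \<Longrightarrow> C \<subseteq> W \<Longrightarrow> touches E S C \<Longrightarrow> C \<subseteq> S"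
    and W: "W = vertices - X" and i: "i < n" and X: "X \<subseteq> vertices" "card (row X i) = 2"
    and ne: "row S i \<noteq> {}" "row (W - S) i \<noteq> {}"
  shows "linked E (row (W - S) i \<times> {i})"
    and "x \<in> row X i \<Longrightarrow> touches E S {(x, i)} \<and> touches E (W - S) {(x, i)}"
    and "x \<in> row X i \<Longrightarrow> y \<in> row X i \<Longrightarrow> \<not> cycle_adj m x y"
proof -
  obtain a b where ab: "row X i = {a, b}" "a \<noteq> b"
    using X(2) by (auto simp: card_2_iff)
  define p q where "p = min a b" and "q = max a b"
  have pq: "row X i = {p, q}" "p < q"
    using ab unfolding p_def q_def by (auto simp: min_def max_def)
  have "q < m"
    using pq row_subset[OF X(1), of i] by auto
  define I J where "I = {p<..<q}" and "J = {..<p} \<union> {q<..<m}"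
  have IJ: "row W i = I \<union> J" "I \<inter> J = {}"
  proof -
    have "row W i = {..<m} - row X i"
      using i unfolding W by (auto simp: row_def)
    moreover have "{..<m} - {p, q} = I \<union> J"
      using pq(2) \<open>q < m\<close> unfolding I_def J_def by auto
    ultimately show "row W i = I \<union> J"
      unfolding pq(1) by (rule trans)
    show "I \<inter> J = {}"
      using pq(2) unfolding I_def J_def by auto
  qed
  have lI: "linked E (I \<times> {i})"
    unfolding I_def by (rule linked_horizontal_between) (use i \<open>q < m\<close> in auto)
  have lJ: "linked E (J \<times> {i})"
    unfolding J_def by (rule linked_horizontal_outside) (use i pq \<open>q < m\<close> in auto)
  have part: "C \<subseteq> row S i" if "linked E (C \<times> {i})" "C \<subseteq> row W i" "C \<inter> row S i \<noteq> {}" for C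
  proof -
    have "C \<times> {i} \<subseteq> S"
      by (rule S(2)) (use that in \<open>auto simp: touches_def\<close>)
    then show ?thesis
      by auto
  qed
  \<comment> \<open>By maximality of \<open>S\<close>, each arc lies in \<open>S\<close> or misses
    it. As both rows are nonempty, \<open>S\<close> receives one arc and its complement in
    \<open>W\<close> the other.\<close>
  have cases: "row S i = I \<and> row (W - S) i = J \<or> row S i = J \<and> row (W - S) i = I"
  proof -
    have "row S i \<union> row (W - S) i = row W i" "row S i \<inter> row (W - S) i = {}"
      using S(1) by auto
    then have un: "row S i \<union> row (W - S) i = I \<union> J" "row S i \<inter> row (W - S) i = {}"
      unfolding IJ(1) by blast+
    have "I \<subseteq> row S i \<or> I \<inter> row S i = {}" "J \<subseteq> row S i \<or> J \<inter> row S i = {}"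
      using part[OF lI] part[OF lJ] IJ(1) by blast+
    then show ?thesis
      using un ne IJ(2) by blast
  qed
  show "linked E (row (W - S) i \<times> {i})"
    using cases lI lJ by auto
  \<comment> \<open>Since both arcs are nonempty, the two removed vertices are not adjacent, and
    each of them has a neighbour in either arc.\<close>
  have neI: "Suc p < q" and neJ: "0 < p \<or> Suc q < m"
    using cases ne unfolding I_def J_def by (auto simp: greaterThanLessThan_empty_iff)
  show "\<not> cycle_adj m x y" if "x \<in> row X i" "y \<in> row X i"
  proof -
    have "\<not> cycle_adj m p q"
      using cycle_adj_less[OF pq(2), of m] neI neJ by auto
    moreover have "\<not> cycle_adj m c c" for c
      using m3 by (auto simp: cycle_adj_def mod_Suc)
    ultimately show ?thesis
      using that cycle_adj_sym unfolding pq(1) by blast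
  qed
  have nI: "\<exists>d\<in>I. cycle_adj m d x" if "x \<in> {p, q}" for x
  proof (cases "x = p")
    case True
    then show ?thesis
      using neI \<open>q < m\<close> unfolding I_def
      by (intro bexI[of _ "Suc p"]) (auto simp: cycle_adj_def)
  next
    case False
    then show ?thesis
      using that neI \<open>q < m\<close> unfolding I_def
      by (intro bexI[of _ "q - 1"]) (auto simp: cycle_adj_def)
  qed
  have nJ: "\<exists>d\<in>J. cycle_adj m d x" if "x \<in> {p, q}" for x
  proof (cases "x = p")
    case True
    show ?thesis
    proof (cases "p = 0")
      case False
      then show ?thesis
        using True pq(2) \<open>q < m\<close> unfolding J_def
        by (intro bexI[of _ "p - 1"]) (auto simp: cycle_adj_def)
    next
      case p0: True
      then show ?thesis
        using True neJ unfolding J_def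
        by (intro bexI[of _ "m - 1"]) (auto simp: cycle_adj_def)
    qed
  next
    case False
    then have "x = q"
      using that by simp
    show ?thesis
    proof (cases "Suc q = m")
      case False
      then show ?thesis
        using \<open>x = q\<close> \<open>q < m\<close> unfolding J_def
        by (intro bexI[of _ "Suc q"]) (auto simp: cycle_adj_def)
    next
      case qm: True
      then show ?thesis
        using \<open>x = q\<close> neJ \<open>q < m\<close> unfolding J_def
        by (intro bexI[of _ 0]) (auto simp: cycle_adj_def)
    qed
  qed
  show "touches E S {(x, i)} \<and> touches E (W - S) {(x, i)}" if "x \<in> row X i"
  proof -
    have "\<exists>d\<in>row S i. cycle_adj m d x" "\<exists>d\<in>row (W - S) i. cycle_adj m d x"
      using cases nI[of x] nJ[of x] that unfolding pq(1) by auto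
    moreover have "touches E Z {(x, i)}" if Z: "\<exists>d\<in>row Z i. cycle_adj m d x" for Z
    proof -
      obtain d where "(d, i) \<in> Z" "cycle_adj m d x"
        using Z by auto
      then show ?thesis
        using row_edge[of d x i] i unfolding touches_def by blast
    qed
    ultimately show ?thesis
      by blast
  qed
qed

text \<open>The rest \<open>T\<close> outside the component \<open>S\<close> need not be connected.
  If it is, size and tie-break choose between the two. If it is not, two consecutive rows of
  \<open>T\<close> share no column; this leaves at most one vertex of \<open>T\<close> in each of
  them and makes \<open>T\<close> smaller than \<open>S\<close>.\<close>

lemma row_bramble_if_two_per_row:
  assumes K: "K \<subseteq> vertices" "linked E K" "K \<inter> X = {}" "\<And>i. i < n \<Longrightarrow> row K i \<noteq> {}"
    and X: "X \<subseteq> vertices" "\<And>i. i < n \<Longrightarrow> card (row X i) = 2"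
    and "0 < n" and mn: "2 * n < m \<or> m = 2 * n \<and> 3 \<le> n"
  shows "\<exists>S. row_bramble S \<and> S \<inter> X = {}"
proof -
  define W where "W = vertices - X"
  have "finite W" "K \<subseteq> W"
    using K(1,3) unfolding W_def by auto
  then obtain S where S: "K \<subseteq> S" "S \<subseteq> W" "linked E S"
    "\<And>C. linked E C \<Longrightarrow> C \<subseteq> W \<Longrightarrow> touches E S C \<Longrightarrow> C \<subseteq> S"
    using linked_component[OF sym_E _ K(2)] by metis
  define T where "T = W - S"
  have sub: "S \<subseteq> vertices" "T \<subseteq> vertices" and dis: "S \<inter> X = {}" "T \<inter> X = {}"
    using S(2) unfolding T_def W_def by auto
  have neS: "row S i \<noteq> {}" if "i < n" for i
    using K(4)[OF that] S(1) unfolding row_def by blast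
  show ?thesis
  proof (cases "\<exists>i<n. m \<le> card (row S i) + 2")
    case True
    then show ?thesis
      using S(3) sub(1) dis(1) neS unfolding row_bramble_def by (intro exI[of _ S]) blast
  next
    case False
    have rows: "card (row S i) + card (row T i) + 2 = m" if "i < n" for i
    proof -
      have "row S i \<union> row T i \<union> row X i = {..<m}"
        using row_subset[OF sub(1), of i] row_subset[OF sub(2), of i] row_subset[OF X(1), of i] that
        unfolding T_def W_def by (auto simp: row_def)
      moreover have "row S i \<inter> row T i = {}" "(row S i \<union> row T i) \<inter> row X i = {}"
        using dis unfolding T_def by auto
      moreover have "finite (row S i)" "finite (row T i)" "finite (row X i)"
        using row_subset[OF sub(1)] row_subset[OF sub(2)] row_subset[OF X(1)]
        by (meson finite_lessThan finite_subset)+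
      ultimately have "card {..<m} = card (row S i) + card (row T i) + card (row X i)"
        by (metis card_Un_disjoint finite_UnI)
      then show ?thesis
        using X(2)[OF that] by simp
    qed
    have neT: "row T i \<noteq> {}" if "i < n" for i
      using rows[OF that] False that by force
    have cut_linked: "linked E (row T i \<times> {i})"
      and cut_touches: "x \<in> row X i \<Longrightarrow> touches E S {(x, i)} \<and> touches E T {(x, i)}"
      and cut_not_adj: "x \<in> row X i \<Longrightarrow> y \<in> row X i \<Longrightarrow> \<not> cycle_adj m x y" if "i < n" for i x y
      using two_cut_row[OF S(2) S(4) W_def that X(1) X(2)[OF that] neS[OF that]] neT[OF that]
      unfolding T_def by blast+
    have total: "card S + card T = n * (m - 2)"
    proof -
      have "card S + card T = (\<Sum>i<n. card (row S i) + card (row T i))"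
        by (simp add: card_rows sub sum.distrib)
      also have "\<dots> = (\<Sum>i<n. m - 2)"
        by (rule sum.cong) (use rows in force)+
      finally show ?thesis
        by simp
    qed
    have rb: "\<exists>S. row_bramble S \<and> S \<inter> X = {}"
      if "linked E Z" "Z = S \<or> Z = T" "n * (m - 2) < 2 * card Z \<or> 2 * card Z = n * (m - 2) \<and>
        (\<exists>j. (j, 0) \<in> Z \<and> (\<forall>j'<j. touches E Z {(j', 0)}))" for Z
      using that sub dis neS neT unfolding row_bramble_def by (intro exI[of _ Z]) auto
    show ?thesis
    proof (cases "linked E T")
      case True
      consider "n * (m - 2) < 2 * card S" | "n * (m - 2) < 2 * card T"
        | "2 * card S = n * (m - 2)" "2 * card T = n * (m - 2)"
        using total by linarith
      then show ?thesis
      proof cases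
        case 1
        then show ?thesis
          using rb[OF S(3)] by simp
      next
        case 2
        then show ?thesis
          using rb[OF True] by simp
      next
        case 3
        \<comment> \<open>\<open>j\<close> is the first column not removed in row 0. All earlier
          vertices of that row are removed and touch both sides, so the side containing
          \<open>(j, 0)\<close> passes the tie-break.\<close>
        define j where "j = (LEAST c. (c, 0) \<in> W)"
        have "\<exists>c. (c, 0) \<in> W"
          using neS[OF \<open>0 < n\<close>] S(2) by auto
        then have j: "(j, 0) \<in> W" "\<And>j'. j' < j \<Longrightarrow> (j', 0) \<notin> W"
          unfolding j_def by (auto intro: LeastI_ex dest: not_less_Least)
        have "touches E S {(j', 0)} \<and> touches E T {(j', 0)}" if "j' < j" for j'
        proof -
          have "(j', 0) \<in> X"
            using j(1) j(2)[OF that] that unfolding W_def by auto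
          then show ?thesis
            using cut_touches[OF \<open>0 < n\<close>] by simp
        qed
        then show ?thesis
          using rb[OF S(3)] rb[OF True] 3 j(1) unfolding T_def by blast
      qed
    next
      case False
      \<comment> \<open>Every row of \<open>T\<close> is a single arc; if consecutive arcs always
        shared a column, they would form a connected chain.\<close>
      have "\<exists>i. Suc i < n \<and> row T i \<inter> row T (Suc i) = {}"
      proof (rule ccontr)
        assume no: "\<not> ?thesis"
        have "linked E (\<Union>i\<le>n - 1. row T i \<times> {i})"
        proof (rule linked_UN_chain[OF sym_E])
          show "linked E (row T i \<times> {i})" if "i \<le> n - 1" for i
            using cut_linked[of i] that \<open>0 < n\<close> by simp
          show "touches E (row T i \<times> {i}) (row T (Suc i) \<times> {Suc i})" if i: "i < n - 1" for i
          proof -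
            have "row T i \<inter> row T (Suc i) \<noteq> {}"
              using no i by (metis less_diff_conv Suc_eq_plus1)
            then obtain c where c: "(c, i) \<in> T" "(c, Suc i) \<in> T"
              by auto
            then have "((c, i), (c, Suc i)) \<in> E"
              using sub(2) by (intro col_edge) auto
            then show ?thesis
              using c unfolding touches_def by auto
          qed
        qed
        moreover have "(\<Union>i\<le>n - 1. row T i \<times> {i}) = T"
          using sub(2) by fastforce
        ultimately show False
          using False by simp
      qed
      then obtain i where i: "Suc i < n" "row T i \<inter> row T (Suc i) = {}"
        by blast
      have no_edge: "(u, v) \<notin> E" "(v, u) \<notin> E" if "u \<in> S" "v \<in> T" for u v
      proof -
        have "\<not> touches E S {v}"
          using S(4)[of "{v}"] that(2) unfolding T_def by auto
        then show "(u, v) \<notin> E" "(v, u) \<notin> E"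
          using that(1) symD[OF sym_E] unfolding touches_def by blast+
      qed
      \<comment> \<open>\<open>S\<close> and \<open>T\<close> are not adjacent, so the vertex below
        one of \<open>T\<close> is in \<open>T\<close> or removed. With two removed per row, row
        sizes of \<open>T\<close> change by at most 2 from row to row.\<close>
      have up: "row T (Suc k) \<subseteq> row T k \<union> row X k" if "Suc k < n" for k
      proof
        fix c assume "c \<in> row T (Suc k)"
        then have "c < m" "(c, k) \<notin> S"
          using no_edge(1)[of "(c, k)" "(c, Suc k)"] col_edge[of c k] sub(2) that by auto
        then show "c \<in> row T k \<union> row X k"
          using that unfolding T_def W_def by simp
      qed
      have down: "row T k \<subseteq> row T (Suc k) \<union> row X (Suc k)" if "Suc k < n" for k
      proof
        fix c assume "c \<in> row T k"
        then have "c < m" "(c, Suc k) \<notin> S"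
          using no_edge(2)[of "(c, Suc k)" "(c, k)"] col_edge[of c k] sub(2) that by auto
        then show "c \<in> row T (Suc k) \<union> row X (Suc k)"
          using that unfolding T_def W_def by simp
      qed
      have fin: "finite (row T k)" "finite (row X k)" for k
        using row_subset[OF sub(2)] row_subset[OF X(1)] by (meson finite_lessThan finite_subset)+
      have two: "card (A \<union> row X k) \<le> card A + 2" if "k < n" for A k
        using card_Un_le[of A "row X k"] X(2)[OF that] by simp
      have grow_up: "card (row T (Suc k)) \<le> card (row T k) + 2" if "Suc k < n" for k
        using card_mono[OF _ up[OF that]] two[of k "row T k"] fin that by fastforce
      have grow_down: "card (row T k) \<le> card (row T (Suc k)) + 2" if "Suc k < n" for k
        using card_mono[OF _ down[OF that]] two[of "Suc k" "row T (Suc k)"] fin that by fastforce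
      \<comment> \<open>Two vertices would form a connected row of \<open>T\<close> and hence be
        adjacent, unlike the two removed vertices of row \<open>l\<close>.\<close>
      have one: "card (row T k) \<le> 1" if "k < n" "l < n" "row T k \<subseteq> row X l" for k l
      proof (rule ccontr)
        assume "\<not> card (row T k) \<le> 1"
        then obtain x y where xy: "x \<in> row T k" "y \<in> row T k" "x \<noteq> y"
          using fin(1)[of k] by (metis One_nat_def card_le_Suc0_iff_eq)
        have "card (row T k) \<le> 2"
          using card_mono[OF fin(2) that(3)] X(2)[OF that(2)] by simp
        then have "row T k = {x, y}"
          using xy fin(1)[of k] card_seteq[of "row T k" "{x, y}"] by simp
        then have "linked E {(x, k), (y, k)}"
          using cut_linked[of k] that(1) by (simp add: insert_Times_insert)
        then have "((x, k), (y, k)) \<in> (E \<inter> {(x, k), (y, k)} \<times> {(x, k), (y, k)})\<^sup>*"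
          unfolding linked_def by blast
        then obtain z where z: "((x, k), z) \<in> E" "z \<in> {(x, k), (y, k)}"
          using xy(3) by (cases rule: converse_rtranclE) auto
        have "((x, k), (x, k)) \<notin> E"
          using m3 by (auto simp: parcs_stacked_prism mod_Suc)
        then have "cycle_adj m x y"
          using z xy(3) by (auto simp: parcs_stacked_prism cycle_adj_def)
        then show False
          using cut_not_adj[OF that(2)] subsetD[OF that(3)] xy(1,2) by blast
      qed
      have "row T (Suc i) \<subseteq> row X i" "row T i \<subseteq> row X (Suc i)"
        using up[OF i(1)] down[OF i(1)] i(2) by blast+
      then have base: "card (row T (Suc i)) \<le> 1" "card (row T i) \<le> 1"
        using one i(1) by (meson Suc_lessD)+
      let ?t = "\<lambda>k. card (row T k)"
      \<comment> \<open>Counted away from the break between rows \<open>i\<close> and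
        \<open>i + 1\<close>, the row sizes are at most 1, 3, 5, ... in both directions. The bound
        is largest when the break is next to an end row.\<close>
      have "card T = (\<Sum>k<n. ?t k)"
        by (rule card_rows[OF sub(2)])
      also have "\<dots> = (\<Sum>k<Suc i. ?t k) + (\<Sum>k<n - Suc i. ?t (Suc i + k))"
        using sum_lessThan_split[of "Suc i" n ?t] i(1) by simp
      also have "(\<Sum>k<Suc i. ?t k) = (\<Sum>k<Suc i. ?t (i - k))"
        by (subst sum.nat_diff_reindex[symmetric]) simp
      also have "(\<Sum>k<Suc i. ?t (i - k)) \<le> (Suc i)\<^sup>2"
      proof (rule sum_growth_two_bound)
        fix k assume "Suc k < Suc i"
        then show "?t (i - Suc k) \<le> ?t (i - k) + 2"
          using grow_down[of "i - Suc k"] i(1) by (simp add: Suc_diff_Suc)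
      qed (use base in simp)
      also have "(\<Sum>k<n - Suc i. ?t (Suc i + k)) \<le> (n - Suc i)\<^sup>2"
      proof (rule sum_growth_two_bound)
        fix k assume "Suc k < n - Suc i"
        then show "?t (Suc i + Suc k) \<le> ?t (Suc i + k) + 2"
          using grow_up[of "Suc i + k"] by simp
      qed (use base in simp)
      also have "(Suc i)\<^sup>2 + (n - Suc i)\<^sup>2 \<le> 1 + (n - 1)\<^sup>2"
        using square_sum_bound[of "Suc i" "n - Suc i"] i(1) by simp
      finally have "card T \<le> 1 + (n - 1)\<^sup>2"
        by simp
      \<comment> \<open>For \<open>m = 2 * n\<close> this amounts to \<open>2 < n\<close>. For
        \<open>2 * n < m\<close> it follows from \<open>4 < 3 * n\<close>, and
        \<open>2 \<le> n\<close> because there are two consecutive rows.\<close>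
      moreover have "2 * (1 + (n - 1)\<^sup>2) < n * (m - 2)"
      proof -
        obtain k where k: "n = k + 2"
          using i(1) le_Suc_ex[of 2 n] by (auto simp: add.commute)
        have "n * (2 * n - 2) \<le> n * (m - 2)" 
          using mn by (intro mult_le_mono2) linarith
        moreover have "n * (2 * n - 1) \<le> n * (m - 2)" if "2 * n < m"
          using that by (intro mult_le_mono2) linarith
        moreover have "2 * (1 + (n - 1)\<^sup>2) < n * (2 * n - 1)"
          unfolding k by (simp add: power2_eq_square algebra_simps)
        moreover have "2 * (1 + (n - 1)\<^sup>2) < n * (2 * n - 2)" if "3 \<le> n"
          using that unfolding k by (simp add: power2_eq_square algebra_simps)
        ultimately show ?thesis
          using mn by linarith
      qed
      moreover have "N < 2 * a" if "b \<le> q" "2 * q < N" "a + b = N" for a b q N :: nat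
        using that by linarith
      ultimately have "n * (m - 2) < 2 * card S"
        using total by blast
      then show ?thesis
        using rb[OF S(3)] by simp
    qed
  qed
qed

end

section \<open>One removed vertex in each column\<close>

lemma sum_rotate:
  fixes g :: "nat \<Rightarrow> nat"
  assumes "a < m"
  shows "(\<Sum>c<m. g c) = (\<Sum>k<m. g ((a + k) mod m))"
proof -
  have eq: "(a + k) mod m = (if a + k < m then a + k else a + k - m)" if "k < m" for k
    using assms that by (simp add: le_mod_geq)
  have "inj_on (\<lambda>k. (a + k) mod m) {..<m}"
    by (rule inj_onI) (auto simp: eq split: if_splits)
  moreover have "(\<lambda>k. (a + k) mod m) ` {..<m} \<subseteq> {..<m}"
    using assms by auto
  ultimately have "(\<lambda>k. (a + k) mod m) ` {..<m} = {..<m}"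
    by (intro endo_inj_surj) auto
  with \<open>inj_on _ _\<close> show ?thesis
    using sum.reindex[of "\<lambda>k. (a + k) mod m" "{..<m}" g] by simp
qed

text \<open>Two nonadjacent zeros cut the cycle into arcs of lengths \<open>e\<close> and
  \<open>m - e\<close>, both at least 2. Each carries at most a tent, and by convexity the worst
  split is into 2 and \<open>m - 2\<close>.\<close>

lemma lipschitz_cycle_sum:
  fixes g :: "nat \<Rightarrow> nat"
  assumes lip: "\<And>c d. cycle_adj m c d \<Longrightarrow> g c \<le> g d + 1"
    and ab: "a < b" "b < m" "g a = 0" "g b = 0" "\<not> cycle_adj m a b"
  shows "4 * (\<Sum>c<m. g c) \<le> 4 + (m - 2)\<^sup>2"
proof -
  define e where "e = b - a"
  have e: "2 \<le> e" "e + 2 \<le> m"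
    using ab(5) ab(1,2) unfolding cycle_adj_less[OF ab(1)] e_def by auto
  define G where "G k = g ((a + k) mod m)" for k
  have adj: "cycle_adj m ((a + k) mod m) ((a + Suc k) mod m)" for k
    using e by (simp add: cycle_adj_def mod_Suc_eq)
  have up: "G (Suc k) \<le> G k + 1" and down: "G k \<le> G (Suc k) + 1" for k
    unfolding G_def by (rule lip, rule adj cycle_adj_sym[OF adj])+
  have zero: "G 0 = 0" "G e = 0" "G m = 0"
    using ab unfolding G_def e_def by simp_all
  have "4 * (\<Sum>k<e. G k) \<le> e\<^sup>2"
    by (rule sum_lipschitz_zero_ends) (use zero up down in auto)
  moreover have "4 * (\<Sum>k<m - e. G (e + k)) \<le> (m - e)\<^sup>2"
    by (rule sum_lipschitz_zero_ends) (use zero e up down in auto)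
  moreover have "(\<Sum>c<m. g c) = (\<Sum>k<e. G k) + (\<Sum>k<m - e. G (e + k))"
    using sum_rotate[of a m g] sum_lessThan_split[of e m G] ab e unfolding G_def by simp
  moreover have "e\<^sup>2 + (m - e)\<^sup>2 \<le> 4 + (m - 2)\<^sup>2"
  proof -
    obtain x where x: "e = 2 + x"
      using e(1) le_Suc_ex by blast
    obtain y where "m = e + 2 + y"
      using e(2) le_Suc_ex by blast
    then show ?thesis
      unfolding x
      by (simp add: power2_eq_square algebra_simps)
  qed
  ultimately show ?thesis
    by linarith
qed

context prism
begin

lemma linked_Un_or_empty:
  "linked E S \<Longrightarrow> linked E T \<Longrightarrow> T = {} \<or> touches E S T \<Longrightarrow> linked E (S \<union> T)"
  using linked_Un[OF sym_E] by fastforce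

text \<open>If every row loses at least two vertices, \<open>card X \<le> 2 * n\<close> forces
  exactly two in each.\<close>

lemma row_bramble_avoiding:
  assumes K: "K \<subseteq> vertices" "linked E K" "K \<inter> X = {}" "\<And>i. i < n \<Longrightarrow> row K i \<noteq> {}"
    and X: "X \<subseteq> vertices" "card X \<le> 2 * n" and "0 < n"
    and mn: "card X < 2 * n \<or> 2 * n < m \<or> m = 2 * n \<and> 3 \<le> n"
  shows "\<exists>S. row_bramble S \<and> S \<inter> X = {}"
proof (cases "\<exists>i<n. card (row X i) \<le> 1")
  case True
  then show ?thesis
    using row_bramble_if_small_row[OF K X(1)] by blast
next
  case False
  then have ge: "2 \<le> card (row X i)" if "i < n" for i
    using that by force
  have "(\<Sum>i<n. 2) \<le> (\<Sum>i<n. card (row X i))"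
    by (rule sum_mono) (use ge in auto)
  then have eq: "card X = 2 * n" "(\<Sum>i<n. 2) = (\<Sum>i<n. card (row X i))"
    using X card_rows[OF X(1)] by simp_all
  have "card (row X i) = 2" if "i < n" for i
    using sum_mono_inv[OF eq(2), of i] ge that by auto
  then show ?thesis
    using row_bramble_if_two_per_row[OF K X(1) _ \<open>0 < n\<close>] mn eq(1) by simp
qed

text \<open>Row \<open>a + 1\<close> lies strictly between the holes and joins the upper part of
  column \<open>c\<close> to the lower part of column \<open>d\<close>. The remaining two parts are
  attached in row 0 and in row \<open>n - 1\<close>.\<close>

lemma linked_two_columns:
  assumes cd: "cycle_adj m c d" and ab: "a + 2 \<le> b" "b < n"
  shows "linked E ({c} \<times> ({..<n} - {a}) \<union> {d} \<times> ({..<n} - {b}))"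
proof -
  have cd': "c < m" "d < m"
    using cd unfolding cycle_adj_def by auto
  have edge: "((c, i), (d, i)) \<in> E" "((d, i), (c, i)) \<in> E" if "i < n" for i
    using row_edge[OF cd that] row_edge[OF cycle_adj_sym[OF cd] that] by auto
  have touch: "touches E S T" if "u \<in> S" "v \<in> T" "(u, v) \<in> E" for S T u v
    using that unfolding touches_def by blast
  let ?A = "{c} \<times> {a<..<n}" and ?B = "{d} \<times> {..<b}" and ?C = "{c} \<times> {..<a}" and ?D = "{d} \<times> {b<..<n}"
  have "touches E ?A ?B"
    by (rule touch[OF _ _ edge(1)[of "Suc a"]]) (use ab in auto)
  then have AB: "linked E (?A \<union> ?B)"
    using cd' ab by (intro linked_Un[OF sym_E] linked_vertical_below linked_vertical_above) auto
  have "?C = {} \<or> touches E (?A \<union> ?B) ?C"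
  proof (cases "a = 0")
    case False
    have "touches E (?A \<union> ?B) ?C"
      by (rule touch[OF _ _ edge(2)[of 0]]) (use ab False in auto)
    then show ?thesis ..
  qed simp
  then have ABC: "linked E ((?A \<union> ?B) \<union> ?C)"
    using cd' ab by (intro linked_Un_or_empty[OF AB] linked_vertical_below) auto
  have "?D = {} \<or> touches E ((?A \<union> ?B) \<union> ?C) ?D"
  proof (cases "Suc b = n")
    case False
    have "touches E ((?A \<union> ?B) \<union> ?C) ?D"
      by (rule touch[OF _ _ edge(1)[of "n - 1"]]) (use ab False in auto)
    then show ?thesis ..
  next
    case True
    then have "{b<..<n} = {}"
      by auto
    then show ?thesis
      by simp
  qed
  then have "linked E (((?A \<union> ?B) \<union> ?C) \<union> ?D)"
    using cd' by (intro linked_Un_or_empty[OF ABC] linked_vertical_above) auto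
  moreover have "(({c} \<times> {a<..<n} \<union> {d} \<times> {..<b}) \<union> {c} \<times> {..<a}) \<union> {d} \<times> {b<..<n}
    = {c} \<times> ({..<n} - {a}) \<union> {d} \<times> ({..<n} - {b})"
    using ab by auto
  ultimately show ?thesis
    by simp
qed

text \<open>A clique of a cycle is empty, a vertex, an edge, or the whole triangle if
  \<open>m = 3\<close>; apart from the triangle, its complement is connected.\<close>

lemma linked_complement_pairwise_adjacent:
  assumes Z: "Z \<subseteq> {..<m}" "\<And>c d. c \<in> Z \<Longrightarrow> d \<in> Z \<Longrightarrow> c < d \<Longrightarrow> cycle_adj m c d" and r: "r < n"
  shows "Z = {..<m} \<or> card Z \<le> 2 \<and> linked E (({..<m} - Z) \<times> {r})"
proof (cases "Z = {}")
  case True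
  have "{..<m} = {0..m - 1}"
    using m3 by auto
  then show ?thesis
    using True linked_horizontal[OF r, of "m - 1" 0] m3 by simp
next
  case False
  define p q where "p = Min Z" and "q = Max Z"
  have fin: "finite Z"
    using Z(1) finite_subset by blast
  then have pq: "p \<in> Z" "q \<in> Z" "Z \<subseteq> {p..q}"
    using False unfolding p_def q_def by auto
  then have less: "p < m" "q < m"
    using Z(1) by auto
  have two: ?thesis if "Z = {p, q}" "{..<m} - {p, q} = {..<p} \<union> {q<..<m}"
    using linked_horizontal_outside[OF r less] that by (simp add: card_insert_if)
  consider "q = p" | "q = Suc p" | "p = 0" "q = m - 1" "p < q"
  proof -
    assume *: "q = p \<Longrightarrow> thesis" "q = Suc p \<Longrightarrow> thesis" "p = 0 \<Longrightarrow> q = m - 1 \<Longrightarrow> p < q \<Longrightarrow> thesis"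
    have "p \<le> q"
      using pq by auto
    then show thesis
      using * Z(2)[OF pq(1,2)] cycle_adj_less[of p q m] by (metis le_neq_implies_less)
  qed
  then show ?thesis
  proof cases
    case 1
    then show ?thesis
      using pq less by (intro two) auto
  next
    case 2
    then show ?thesis
      using pq less by (intro two) auto
  next
    case 3
    show ?thesis
    proof (cases "Z = {p, q}")
      case True
      have "{..<m} - {p, q} = {0<..<m - 1}"
        using 3 m3 by auto
      then show ?thesis
        using True linked_horizontal_between[OF r, of "m - 1" 0] 3 m3 by (simp add: card_insert_if)
    next
      case False
      then obtain y where y: "y \<in> Z" "0 < y" "y < m - 1"
        using pq 3 by force
      \<comment> \<open>A third vertex \<open>y\<close> would be adjacent to both 0 and
        \<open>m - 1\<close>, which leaves only the triangle.\<close>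
      have y1: "y = 1"
        using Z(2)[OF pq(1) y(1)] cycle_adj_less[of p y m] 3 y by auto
      have my: "m - 1 = Suc y"
        using Z(2)[OF y(1) pq(2)] cycle_adj_less[of y q m] 3 y by auto
      have "Z = {..<m}"
      proof -
        have "m = 3"
          using y1 my by simp
        then have "{..<m} = {0, 1, 2}"
          by auto
        moreover have "0 \<in> Z" "1 \<in> Z" "2 \<in> Z"
          using pq(1,2) y(1) 3 y1 \<open>m = 3\<close> by simp_all
        ultimately have "{..<m} \<subseteq> Z"
          by simp
        with Z(1) show ?thesis
          by (rule equalityI)
      qed
      then show ?thesis
        by simp
    qed
  qed
qed

text \<open>Two nonadjacent zeros make the sum small. Otherwise the zeros form a clique: either
  \<open>g\<close> vanishes, or there are at most two zeros and their complement is
  connected.\<close>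

lemma lipschitz_zeros:
  fixes g :: "nat \<Rightarrow> nat"
  assumes lip: "\<And>c d. cycle_adj m c d \<Longrightarrow> g c \<le> g d + 1"
    and mn: "m < 2 * n \<or> m = 2 * n \<and> 3 \<le> n" and r: "r < n"
  shows "2 * (\<Sum>c<m. g c) < m * (n - 1) \<or>
    card {c. c < m \<and> g c = 0} \<le> 2 \<and> linked E ({c. c < m \<and> g c \<noteq> 0} \<times> {r})"
proof -
  let ?Z = "{c. c < m \<and> g c = 0}"
  show ?thesis
  proof (cases "\<forall>c\<in>?Z. \<forall>d\<in>?Z. c < d \<longrightarrow> cycle_adj m c d")
    case True
    then have "?Z = {..<m} \<or> card ?Z \<le> 2 \<and> linked E (({..<m} - ?Z) \<times> {r})"
      by (intro linked_complement_pairwise_adjacent r) auto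
    then show ?thesis
    proof
      assume "?Z = {..<m}"
      then have "(\<Sum>c<m. g c) = 0"
        by auto
      moreover have "1 < n"
        using mn m3 by linarith
      ultimately show ?thesis
        using m3 by simp
    next
      assume "card ?Z \<le> 2 \<and> linked E (({..<m} - ?Z) \<times> {r})"
      moreover have "{..<m} - ?Z = {c. c < m \<and> g c \<noteq> 0}"
        by auto
      ultimately show ?thesis
        by simp
    qed
  next
    case False
    then obtain a b where "a < b" "b < m" "g a = 0" "g b = 0" "\<not> cycle_adj m a b"
      by auto
    then have le: "4 * (\<Sum>c<m. g c) \<le> 4 + (m - 2)\<^sup>2"
      by (intro lipschitz_cycle_sum lip)
    \<comment> \<open>For \<open>m < 2 * n\<close>, use \<open>m - 1 \<le> 2 * (n - 1)\<close> and
      \<open>8 < 3 * m\<close>. For \<open>m = 2 * n\<close> the inequality amounts to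
      \<open>2 < n\<close>.\<close>
    have "4 + (m - 2)\<^sup>2 < 2 * (m * (n - 1))"
    proof (cases "m < 2 * n")
      case True
      obtain k where k: "m = k + 3"
        using m3 by (metis add.commute le_Suc_ex)
      have "4 + (m - 2)\<^sup>2 < m * (m - 1)"
        unfolding k by (simp add: power2_eq_square algebra_simps)
      also have "\<dots> \<le> m * (2 * (n - 1))"
        using True by (intro mult_le_mono2) linarith
      finally show ?thesis
        by (simp add: algebra_simps)
    next
      case False
      then obtain k where "n = 3 + k"
        using mn le_Suc_ex[of 3 n] by blast
      then have k: "n = k + 3" "m = 2 * k + 6"
        using False mn by simp_all
      show ?thesis
        unfolding k by (simp add: power2_eq_square algebra_simps)
    qed
    then show ?thesis
      using le by simp
  qed
qed

text \<open>The set is a comb: row \<open>r\<close> is its spine, and the columns are its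
  teeth.\<close>

lemma linked_over_row:
  assumes "S \<subseteq> vertices" "r < n" "linked E (row S r \<times> {r})"
    and "\<And>c. c < m \<Longrightarrow> linked E ({c} \<times> col S c)"
    and "\<And>c. c < m \<Longrightarrow> col S c \<noteq> {} \<Longrightarrow> r \<in> col S c"
  shows "linked E S"
proof -
  have rows: "row S r \<subseteq> {..<m}"
    by (rule row_subset) fact
  have "linked E (row S r \<times> {r} \<union> (\<Union>c\<in>row S r. {c} \<times> col S c))"
  proof (rule linked_UN_star[OF sym_E _ assms(3)])
    show "finite (row S r)"
      using rows finite_subset by blast
    fix c assume c: "c \<in> row S r"
    then have "(c, r) \<in> row S r \<times> {r}" "(c, r) \<in> {c} \<times> col S c"
      by simp_all
    then show "linked E ({c} \<times> col S c) \<and> touches E (row S r \<times> {r}) ({c} \<times> col S c)"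
      using assms(4)[of c] subsetD[OF rows c] unfolding touches_def by blast
  qed
  moreover have "row S r \<times> {r} \<union> (\<Union>c\<in>row S r. {c} \<times> col S c) = S"
    using assms(1,5) by (auto; force)
  ultimately show ?thesis
    by simp
qed

text \<open>If the heights of the removed vertices vary slowly, then the parts below and above them are
  the relevant components.\<close>

lemma col_bramble_avoiding_graph:
  assumes h: "\<And>c. c < m \<Longrightarrow> h c < n"
    and lip: "\<And>c d. cycle_adj m c d \<Longrightarrow> h c \<le> h d + 1"
    and mn: "m < 2 * n \<or> m = 2 * n \<and> 3 \<le> n"
  shows "\<exists>S. col_bramble S \<and> (\<forall>c<m. (c, h c) \<notin> S)"
proof -
  have "0 < n"
    using mn by auto
  define L U where "L = {(c, y). c < m \<and> y < h c}" and "U = {(c, y). c < m \<and> h c < y \<and> y < n}"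
  have sub: "L \<subseteq> vertices" "U \<subseteq> vertices"
    using h unfolding L_def U_def by force+
  have colL: "col L c = {..<h c}" and colU: "col U c = {h c<..<n}" if "c < m" for c
    using that unfolding L_def U_def by (auto simp: col_def)
  have rowL: "row L 0 = {c. c < m \<and> h c \<noteq> 0}"
    unfolding L_def by (auto simp: row_def)
  have rowU: "row U (n - 1) = {c. c < m \<and> n - 1 - h c \<noteq> 0}"
    using \<open>0 < n\<close> unfolding U_def by (auto simp: row_def)
  have cardL: "card L = (\<Sum>c<m. h c)" and cardU: "card U = (\<Sum>c<m. n - 1 - h c)"
    unfolding card_cols[OF sub(1)] card_cols[OF sub(2)] by (rule sum.cong; simp add: colL colU)+
  have total: "card L + card U = m * (n - 1)"
  proof -
    have "card L + card U = (\<Sum>c<m. h c + (n - 1 - h c))"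
      unfolding cardL cardU by (simp add: sum.distrib)
    also have "\<dots> = (\<Sum>c<m. n - 1)"
      by (rule sum.cong) (use h in fastforce)+
    finally show ?thesis
      by simp
  qed
  have large: "m \<le> card {c. c < m \<and> P c} + 2" if "card {c. c < m \<and> \<not> P c} \<le> 2" for P
  proof -
    have "{c. c < m \<and> P c} \<union> {c. c < m \<and> \<not> P c} = {..<m}"
      by auto
    then show ?thesis
      using card_Un_le[of "{c. c < m \<and> P c}" "{c. c < m \<and> \<not> P c}"] that by simp
  qed
  have L: "2 * card L < m * (n - 1) \<or> m \<le> card (row L 0) + 2 \<and> linked E L"
  proof -
    consider "2 * card L < m * (n - 1)"
      | "card {c. c < m \<and> h c = 0} \<le> 2" "linked E (row L 0 \<times> {0})"
      using lipschitz_zeros[where g = h and r = 0, OF lip mn \<open>0 < n\<close>] unfolding cardL rowL by blast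
    then show ?thesis
    proof cases
      case 2
      have "linked E L"
        by (rule linked_over_row[OF sub(1) \<open>0 < n\<close> 2(2)])
          (use h in \<open>auto simp: colL less_imp_le intro!: linked_vertical_below\<close>)
      then show ?thesis
        using large[of "\<lambda>c. h c \<noteq> 0"] 2(1) unfolding rowL by simp
    qed simp
  qed
  have U: "2 * card U < m * (n - 1) \<or> m \<le> card (row U (n - 1)) + 2 \<and> linked E U"
  proof -
    \<comment> \<open>Turned upside down, the heights become \<open>n - 1 - h c\<close>, which vary
      just as slowly.\<close>
    have lip': "n - 1 - h c \<le> n - 1 - h d + 1" if "cycle_adj m c d" for c d
      using lip[OF cycle_adj_sym[OF that]] by linarith
    have r: "n - 1 < n"
      using \<open>0 < n\<close> by simp
    consider "2 * card U < m * (n - 1)"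
      | "card {c. c < m \<and> n - 1 - h c = 0} \<le> 2" "linked E (row U (n - 1) \<times> {n - 1})"
      using lipschitz_zeros[where g = "\<lambda>c. n - 1 - h c" and r = "n - 1", OF lip' mn r] unfolding cardU rowU by blast
    then show ?thesis
    proof cases
      case 2
      have "linked E U"
        by (rule linked_over_row[OF sub(2) r 2(2)])
          (auto simp: colU greaterThanLessThan_empty_iff intro!: linked_vertical_above)
      then show ?thesis
        using large[of "\<lambda>c. n - 1 - h c \<noteq> 0"] 2(1) unfolding rowU by simp
    qed simp
  qed
  \<comment> \<open>A tie goes to \<open>L\<close>, because the tie-break of
    \<open>col_bramble\<close> asks for a large row 0, and that is the row found for
    \<open>L\<close>.\<close>
  consider "m * (n - 1) < 2 * card L" | "2 * card L = m * (n - 1)" | "m * (n - 1) < 2 * card U"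
    using total by linarith
  then have "col_bramble L \<or> col_bramble U"
    using L U sub \<open>0 < n\<close> unfolding col_bramble_def
    by cases (auto intro: diff_less)
  then show ?thesis
    unfolding L_def U_def by auto
qed

section \<open>The lower bound\<close>

lemma bramble_avoiding:
  assumes X: "X \<subseteq> vertices" "card X \<le> m" "card X \<le> 2 * n" and "0 < n"
    and mn: "card X < 2 * n \<or> 2 * n < m \<or> m = 2 * n \<and> 3 \<le> n"
  shows "\<exists>S. (row_bramble S \<or> col_bramble S) \<and> S \<inter> X = {}"
proof (cases "\<exists>c<m. col X c = {}")
  case True
  then obtain c where c: "c < m" "col X c = {}"
    by blast
  have "\<exists>S. row_bramble S \<and> S \<inter> X = {}"
  proof (rule row_bramble_avoiding[OF _ _ _ _ X(1,3) \<open>0 < n\<close> mn])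
    show "linked E ({c} \<times> {..<n})"
      using c(1) by (rule linked_vertical_below) simp
    show "({c} \<times> {..<n}) \<inter> X = {}"
      using c(2) by auto
  qed (use c in \<open>auto simp: row_def\<close>)
  then show ?thesis
    by blast
next
  case False
  have fin: "finite (col X c)" for c
    using col_subset[OF X(1), of c] finite_subset by blast
  have ge: "1 \<le> card (col X c)" if "c < m" for c
    using False that fin[of c] by (simp add: Suc_le_eq card_gt_0_iff)
  have "(\<Sum>c<m. 1) \<le> (\<Sum>c<m. card (col X c))"
    by (rule sum_mono) (use ge in auto)
  then have eq: "card X = m" "(\<Sum>c<m. 1) = (\<Sum>c<m. card (col X c))"
    using X card_cols[OF X(1)] by simp_all
  have "card (col X c) = 1" if "c < m" for c
    using sum_mono_inv[OF eq(2), of c] ge that by auto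
  then have "\<forall>c\<in>{..<m}. \<exists>y. col X c = {y}"
    by (simp add: card_1_singleton_iff)
  then obtain h where h: "\<And>c. c < m \<Longrightarrow> col X c = {h c}"
    by (metis lessThan_iff)
  then have hn: "h c < n" if "c < m" for c
    using col_subset[OF X(1), of c] that by auto
  have Xh: "(c, y) \<in> X \<longleftrightarrow> c < m \<and> y = h c" for c y
  proof (cases "c < m")
    case True
    have "y \<in> col X c \<longleftrightarrow> y = h c"
      by (simp only: h[OF True] singleton_iff)
    then show ?thesis
      using True by simp
  qed (use X(1) in auto)
  show ?thesis
  proof (cases "\<forall>c d. cycle_adj m c d \<longrightarrow> h c \<le> h d + 1")
    case True
    \<comment> \<open>Here \<open>card X = m\<close>, hence \<open>m \<le> 2 * n\<close>; the
      alternatives in \<open>mn\<close> therefore leave \<open>m < 2 * n\<close>, or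
      \<open>m = 2 * n\<close> with \<open>3 \<le> n\<close>.\<close>
    then obtain S where "col_bramble S" "\<forall>c<m. (c, h c) \<notin> S"
      using col_bramble_avoiding_graph[of h] hn mn eq(1) X(3) by (metis le_neq_implies_less not_less)
    then show ?thesis
      using Xh by (intro exI[of _ S]) auto
  next
    case False
    then obtain c d where cd: "cycle_adj m d c" "h d + 2 \<le> h c"
      by (metis Suc_eq_plus1 add_2_eq_Suc' cycle_adj_sym not_less_eq_eq)
    have less: "c < m" "d < m"
      using cd(1) unfolding cycle_adj_def by auto
    let ?K = "{d} \<times> ({..<n} - {h d}) \<union> {c} \<times> ({..<n} - {h c})"
    have "\<exists>S. row_bramble S \<and> S \<inter> X = {}"
    proof (rule row_bramble_avoiding[OF _ _ _ _ X(1,3) \<open>0 < n\<close> mn])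
      show "linked E ?K"
        by (rule linked_two_columns[OF cd hn[OF less(1)]])
      show "?K \<inter> X = {}"
        using Xh by auto
      show "row ?K i \<noteq> {}" if "i < n" for i
      proof -
        have "d \<in> row ?K i \<or> c \<in> row ?K i"
          using that cd(2) by auto
        then show ?thesis
          by blast
      qed
    qed (use less in auto)
    then show ?thesis
      by blast
  qed
qed

text \<open>The free parameter \<open>k\<close> allows \<open>2 * n - 1\<close> in the tight case
  \<open>m = 2 * n\<close>, where \<open>2 * n\<close> itself would require
  \<open>3 \<le> n\<close>.\<close>

lemma treewidth_ge:
  assumes "k \<le> m" "k \<le> 2 * n" "0 < n" "k < 2 * n \<or> 2 * n < m \<or> m = 2 * n \<and> 3 \<le> n"
  shows "int k \<le> treewidth (stacked_prism m n)"
proof (rule treewidth_ge_bramble[where F = "{S. row_bramble S \<or> col_bramble S}"])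
  show "pair_graph (stacked_prism m n)"
    using m3 by (rule pair_graph_stacked_prism)
  show "S \<subseteq> pverts (stacked_prism m n) \<and> linked E S" if "S \<in> {S. row_bramble S \<or> col_bramble S}" for S
    using that unfolding pverts_stacked_prism row_bramble_def col_bramble_def by blast
  show "touches E S T" if "S \<in> {S. row_bramble S \<or> col_bramble S}"
    "T \<in> {S. row_bramble S \<or> col_bramble S}" for S T
    using that row_bramble_touches_row_bramble row_bramble_touches_col_bramble
      col_bramble_touches_col_bramble touches_sym[OF sym_E] by blast
  show "\<exists>S\<in>{S. row_bramble S \<or> col_bramble S}. S \<inter> X = {}"
    if "X \<subseteq> pverts (stacked_prism m n)" "card X \<le> k" for X
    using bramble_avoiding[of X] that assms unfolding pverts_stacked_prism by auto
qed

end

theorem theorem1p1: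
  shows "(\<forall>m n :: nat. 3 \<le> m \<longrightarrow> 1 \<le> n \<longrightarrow>
            (m \<noteq> 2 * n \<longrightarrow> treewidth (stacked_prism m n) = int (min m (2 * n))) \<and>
            (m = 2 * n \<longrightarrow>
               treewidth (stacked_prism m n) = int (min m (2 * n)) - 1 \<or>
               treewidth (stacked_prism m n) = int (min m (2 * n)))) \<and>
         (\<exists>n :: nat. 1 \<le> n \<and> 3 \<le> 2 * n \<and>
            treewidth (stacked_prism (2 * n) n) = 2 * int n - 1) \<and>
         (\<exists>n :: nat. 1 \<le> n \<and> 3 \<le> 2 * n \<and>
            treewidth (stacked_prism (2 * n) n) = 2 * int n)"
proof -
  have upper: "treewidth (stacked_prism m n) \<le> int (min m (2 * n))" if "3 \<le> m" "1 \<le> n" for m n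
    using treewidth_stacked_prism_le_rows[OF that] treewidth_stacked_prism_le_columns[OF that]
    by (simp add: min_def)
  have lower: "int k \<le> treewidth (stacked_prism m n)"
    if "3 \<le> m" "k \<le> m" "k \<le> 2 * n" "1 \<le> n" "k < 2 * n \<or> 2 * n < m \<or> m = 2 * n \<and> 3 \<le> n" for k m n
    by (rule prism.treewidth_ge) (use that in \<open>simp_all add: prism_def\<close>)
  have unequal: "treewidth (stacked_prism m n) = int (min m (2 * n))"
    if "3 \<le> m" "1 \<le> n" "m \<noteq> 2 * n" for m n
    using upper[OF that(1,2)] lower[of m "min m (2 * n)" n] that by (simp add: min_def split: if_splits)
  have equal: "int (2 * n) - 1 \<le> treewidth (stacked_prism (2 * n) n)" if "3 \<le> 2 * n" for n
    using lower[of "2 * n" "2 * n - 1" n] that by (simp add: of_nat_diff)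
  \<comment> \<open>This prism is the three-dimensional cube.\<close>
  have "treewidth (stacked_prism (2 * 2) 2) = 2 * int 2 - 1"
    using treewidth_cube_le equal[of 2] by simp
  \<comment> \<open>The witness 3 is the least \<open>n\<close> for which the counting works with
    \<open>k = 2 * n\<close>.\<close>
  moreover have "treewidth (stacked_prism (2 * 3) 3) = 2 * int 3"
    using upper[of 6 3] lower[of 6 6 3] by simp
  moreover have "treewidth (stacked_prism m n) = int (min m (2 * n)) - 1 \<or>
      treewidth (stacked_prism m n) = int (min m (2 * n))" if "3 \<le> m" "1 \<le> n" "m = 2 * n" for m n
    using upper[OF that(1,2)] equal[of n] that by auto
  moreover have "(1 :: nat) \<le> 2" "3 \<le> 2 * (2 :: nat)" "(1 :: nat) \<le> 3" "3 \<le> 2 * (3 :: nat)"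
    by simp_all
  ultimately show ?thesis
    using unequal by blast
qed

end
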